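(* Let $\mathbb G=(V,E)$ be a ribbon graph and let $\prec$ be a total ordering of its edge set. Then \begin{multline*} Q(\mathbb{G}; (\boldsymbol\alpha, \boldsymbol\beta, \boldsymbol\gamma) , t) = t^{k(\mathbb{G})} \sum_{(X,Y,Z)\in\mathcal{Q}(\mathbb{G})} \prod_{e\in\mathrm{IA}(X)}\alpha_e \prod_{e\in\mathrm{IA}(Y)}\beta_e \prod_{e\in\mathrm{IA}(Z)}\gamma_e \prod_{e\in\mathrm{AO}(X)}\Big( \frac{t\beta_e}{2}+\alpha_e \Big) \prod_{e\in\mathrm{AO}(Y)}\Big( \frac{t\alpha_e}{2}+\beta_e \Big) \\ \cdot\prod_{e\in\mathrm{AO}(Z)}\Big( \frac{t\beta_e}{2}+\gamma_e \Big) \prod_{e\in\mathrm{AN}(X)}\Big( \frac{t\gamma_e}{2}+\alpha_e \Big) \prod_{e\in\mathrm{AN}(Y)}\Big( \frac{t\gamma_e}{2}+\beta_e \Big) \prod_{e\in\mathrm{AN}(Z)}\Big( \frac{t\alpha_e}{2}+\gamma_e \Big). \end{multline*}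
   Context: A ribbon graph $\mathbb G=(V,E)$ is a surface with boundary given as a union of discs, vertices $V$ and edges $E$, such that vertices and edges meet in disjoint line segments, each lying on the boundary of exactly one vertex and one edge, and each edge contains exactly two such segments. $b(\mathbb G)$ is the number of boundary components, $k(\mathbb G)$ the number of connected components. $\mathbb G\setminus Y$ deletes the edges in $Y$. The partial Petrial $\mathbb G^{\tau(e)}$ is obtained by detaching one end of $e$ from its incident vertex and reattaching it with a half-twist (identifying the arcs antipodally); $\mathbb G^{\tau(Z)}$ does this for every $e\in Z$; edge sets are identified. $\mathcal P_3(E)$ is the set of ordered partitions $(X,Y,Z)$ of $E$ into three possibly empty blocks. For indeterminates $\alpha_e,\beta_e,\gamma_e$ ($e\in E$) and $t$, the topological transition polynomial is $Q(\mathbb G;(\boldsymbol\alpha,\boldsymbol\beta,\boldsymbol\gamma),t)=\sum_{(X,Y,Z)\in\mathcal P_3(E)}\prod_{e\in X}\alpha_e\prod_{e\in Y}\beta_e\prod_{e\in Z}\gamma_e\, t^{b(\mathbb G^{\tau(Z)}\setminus Y)}$. Let $\mathcal Q(\mathbb G)=\{(X,Y,Z)\in\mathcal P_3(E): b(\mathbb G^{\tau(Z)}\setminus Y)=k(\mathbb G)\}$. For $(X,Y,Z)\in\mathcal Q(\mathbb G)$, for each component of $\mathbb G$ the unique corresponding boundary component of $\mathbb G^{\tau(Z)}\setminus Y$ defines a curve $\partial$ in $\mathbb G^{\tau(Z)}$ meeting each edge $e$ of that component in exactly two arcs $e_1,e_2$; orient each edge arbitrarily (so $e_1,e_2$ are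 directed) and orient $\partial$ arbitrarily. $e$ is $(X,Y,Z)$-nonorientable if exactly one of $e_1,e_2$ agrees with the direction of $\partial$, and $(X,Y,Z)$-orientable otherwise. Edges $e,f$ are $(X,Y,Z)$-interlaced if travelling around $\partial$ they are met in cyclic order $efef$. $e$ is active w.r.t. $(X,Y,Z)$ if it is not $(X,Y,Z)$-interlaced with any edge $f\prec e$, inactive otherwise. For $S\subseteq E$, $\mathrm{IA}(S)$, $\mathrm{AO}(S)$, $\mathrm{AN}(S)$ are the edges of $S$ that are inactive, active and orientable, active and nonorientable (w.r.t. $(X,Y,Z)$), respectively. *)

theory Defs
  imports Main "HOL.Rat" "HOL-Library.Poly_Mapping" "HOL-Combinatorics.Transposition"
begin

section \<open>Ribbon graphs\<close>

text \<open>
  A ribbon graph is a union of vertex discs and edge discs that meet in disjoint segments of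
  their boundary circles.  Up to homeomorphism such a surface is determined by the boundary circles
  of the discs and by the way in which the segments lie on them, and this is what is recorded here.
  The \<^emph>\<open>corners\<close> are the end points of the segments, and they cut the boundary circles into

  \<^item> the segments (common to one vertex disc and one edge disc);
  \<^item> the sides of the edges (the rest of the boundary circles of the edge discs);
  \<^item> the free vertex arcs (the rest of the boundary circles of the vertex discs).

  Every corner is an end point of exactly one arc of each of these three kinds; \<open>segm\<close>, \<open>eside\<close>
  and \<open>varc\<close> send a corner to the other end of that arc. A vertex disc that meets no edge is a
  vertex without corners.
\<close>

record ('v, 'e, 'c) ribbon_graph =
  verts :: "'v set"
  edges :: "'e set"
  corners :: "'c set"
  vert_of :: "'c \<Rightarrow> 'v"
  edge_of :: "'c \<Rightarrow> 'e"
  segm :: "'c \<Rightarrow> 'c"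
  eside :: "'c \<Rightarrow> 'c"
  varc :: "'c \<Rightarrow> 'c"

definition pairing_on :: "'c set \<Rightarrow> ('c \<Rightarrow> 'c) \<Rightarrow> bool" where
  "pairing_on A f \<longleftrightarrow> (\<forall>c\<in>A. f c \<in> A \<and> f c \<noteq> c \<and> f (f c) = c)"

definition joined :: "'c set \<Rightarrow> ('c \<Rightarrow> 'c) \<Rightarrow> ('c \<Rightarrow> 'c) \<Rightarrow> 'c rel" where
  "joined A f g = ({(c, f c) | c. c \<in> A} \<union> {(c, g c) | c. c \<in> A})\<^sup>*"

text \<open>
  The reachability conditions say that all corners of a disc lie on one circle, and the
  condition on the cardinality says that every edge disc contains exactly two segments.
\<close>

definition ribbon_graph :: "('v, 'e, 'c) ribbon_graph \<Rightarrow> bool" where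
  "ribbon_graph G \<longleftrightarrow>
     finite (verts G) \<and> finite (edges G) \<and> finite (corners G) \<and>
     pairing_on (corners G) (segm G) \<and>
     pairing_on (corners G) (eside G) \<and>
     pairing_on (corners G) (varc G) \<and>
     (\<forall>c\<in>corners G. vert_of G c \<in> verts G \<and> edge_of G c \<in> edges G \<and>
        vert_of G (segm G c) = vert_of G c \<and> vert_of G (varc G c) = vert_of G c \<and>
        edge_of G (segm G c) = edge_of G c \<and> edge_of G (eside G c) = edge_of G c) \<and>
     (\<forall>c\<in>corners G. \<forall>d\<in>corners G. vert_of G c = vert_of G d \<longrightarrow>
        (c, d) \<in> joined (corners G) (segm G) (varc G)) \<and>
     (\<forall>c\<in>corners G. \<forall>d\<in>corners G. edge_of G c = edge_of G d \<longrightarrow>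
        (c, d) \<in> joined (corners G) (segm G) (eside G)) \<and>
     (\<forall>e\<in>edges G. card {c \<in> corners G. edge_of G c = e} = 4)"

text \<open>
  The two sides of an edge join its two ends, so connectedness of the surface is generated by
  the pairs of vertices at the ends of the sides.
\<close>

definition num_components :: "('v, 'e, 'c) ribbon_graph \<Rightarrow> nat" where
  "num_components G =
     card (verts G // {(vert_of G c, vert_of G (eside G c)) | c. c \<in> corners G}\<^sup>*)"

text \<open>
  The boundary of the surface consists of the sides of the edges and the free vertex arcs,
  joined at the corners, and of the whole boundary circles of the isolated vertices.
\<close>

definition num_boundary :: "('v, 'e, 'c) ribbon_graph \<Rightarrow> nat" where
  "num_boundary G =
     card (corners G // joined (corners G) (eside G) (varc G)) +
     card {v \<in> verts G. \<forall>c\<in>corners G. vert_of G c \<noteq> v}"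

text \<open>
  Deleting edges: their segments become part of the free vertex arcs.  The new arc at a
  remaining corner follows the boundary circle of the vertex, across the segments of deleted edges,
  up to the first remaining corner.
\<close>

definition delete_edges :: "('v, 'e, 'c) ribbon_graph \<Rightarrow> 'e set \<Rightarrow> ('v, 'e, 'c) ribbon_graph" where
  "delete_edges G Y = G\<lparr>
     edges := edges G - Y,
     corners := {c \<in> corners G. edge_of G c \<notin> Y},
     varc := (\<lambda>c. let walk = (\<lambda>n. ((varc G \<circ> segm G) ^^ n) (varc G c))
                  in walk (LEAST n. edge_of G (walk n) \<notin> Y))\<rparr>"

text \<open>
  Detaching the end of an edge with segment \<open>{p, segm G p}\<close> and reattaching it with a
  half-twist, that is, with the segment of the edge identified antipodally with that of the vertex:
  in the boundary circle of the edge disc, the corners \<open>p\<close> and \<open>segm G p\<close> change places.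
\<close>

definition twist_end :: "('v, 'e, 'c) ribbon_graph \<Rightarrow> 'c \<Rightarrow> ('v, 'e, 'c) ribbon_graph" where
  "twist_end G p = G\<lparr>eside :=
     transpose p (segm G p) \<circ> eside G \<circ> transpose p (segm G p)\<rparr>"

text \<open>
  Whichever end of \<open>e\<close> is twisted, the side that led from a corner \<open>c\<close> to \<open>eside G c\<close> then leads to
  the other corner of the same segment (\<open>twist_end_eq_partial_petrial\<close>).
\<close>

definition partial_petrial :: "('v, 'e, 'c) ribbon_graph \<Rightarrow> 'e set \<Rightarrow> ('v, 'e, 'c) ribbon_graph" where
  "partial_petrial G Z = G\<lparr>eside :=
     (\<lambda>c. if edge_of G c \<in> Z then segm G (eside G c) else eside G c)\<rparr>"

lemma segm_eside_commute:
  assumes "ribbon_graph G" "c \<in> corners G"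
  shows "segm G (eside G c) = eside G (segm G c)"
    and "{d \<in> corners G. edge_of G d = edge_of G c} =
           {c, segm G c, eside G c, segm G (eside G c)}"
    and "distinct [c, segm G c, eside G c, segm G (eside G c)]"
proof -
  let ?C = "corners G" and ?s = "segm G" and ?t = "eside G"
  let ?K = "{d \<in> corners G. edge_of G d = edge_of G c}"
  have s: "\<And>x. x \<in> ?C \<Longrightarrow> ?s x \<in> ?C \<and> ?s x \<noteq> x \<and> ?s (?s x) = x"
    and t: "\<And>x. x \<in> ?C \<Longrightarrow> ?t x \<in> ?C \<and> ?t x \<noteq> x \<and> ?t (?t x) = x"
    and e: "\<And>x. x \<in> ?C \<Longrightarrow> edge_of G (?s x) = edge_of G x \<and> edge_of G (?t x) = edge_of G x"
    and card: "card ?K = 4"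
    using assms unfolding ribbon_graph_def pairing_on_def by auto
  have reach: "(c, d) \<in> joined ?C ?s ?t" if "d \<in> ?K" for d
    using assms that unfolding ribbon_graph_def by auto
  have closed: "?K \<subseteq> A" if c: "c \<in> A" and A: "\<And>x. x \<in> A \<Longrightarrow> ?s x \<in> A \<and> ?t x \<in> A" for A
  proof
    fix d assume "d \<in> ?K"
    from reach[OF this] show "d \<in> A"
      unfolding joined_def by (induction rule: rtrancl_induct) (use c A in auto)
  qed
  have neq: "?s c \<noteq> ?t c"
  proof
    assume eq: "?s c = ?t c"
    have "?K \<subseteq> {c, ?s c}"
      by (rule closed) (use s[OF assms(2)] t[OF assms(2)] eq in auto)
    from card_mono[OF _ this] card show False by (auto simp: card_insert_if split: if_splits)
  qed
  let ?u = "?s (?t c)"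
  have dist: "distinct [c, ?s c, ?t c, ?u]"
    using s[OF assms(2)] t[OF assms(2)] neq s[of "?t c"] by auto
  have sub: "{c, ?s c, ?t c, ?u} \<subseteq> ?K"
    using s t e assms(2) by auto
  have "finite ?K" using card by (metis card.infinite zero_neq_numeral)
  moreover have "card {c, ?s c, ?t c, ?u} = 4" using dist by simp
  ultimately have K: "?K = {c, ?s c, ?t c, ?u}"
    using card_subset_eq[OF _ sub] card by simp
  have "?t (?s c) \<in> ?K" using s t e assms(2) by auto
  then have "?t (?s c) \<in> {c, ?s c, ?t c, ?u}" using K by simp
  moreover have "?t (?s c) \<noteq> c" using t[of "?s c"] s[OF assms(2)] neq by metis
  moreover have "?t (?s c) \<noteq> ?s c" using t s assms(2) by auto
  moreover have "?t (?s c) \<noteq> ?t c" using t s assms(2) by metis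
  ultimately show "?u = ?t (?s c)" by auto
  show "?K = {c, ?s c, ?t c, ?u}" by (rule K)
  show "distinct [c, ?s c, ?t c, ?u]" by (rule dist)
qed

lemma twist_end_eq_partial_petrial:
  assumes G: "ribbon_graph G" and p: "p \<in> corners G" and c: "c \<in> corners G"
  shows "eside (twist_end G p) c = eside (partial_petrial G {edge_of G p}) c"
proof -
  let ?s = "segm G" and ?t = "eside G"
  have s: "\<And>x. x \<in> corners G \<Longrightarrow> ?s x \<in> corners G \<and> ?s (?s x) = x \<and> edge_of G (?s x) = edge_of G x"
    and t: "\<And>x. x \<in> corners G \<Longrightarrow> ?t x \<in> corners G \<and> ?t (?t x) = x \<and> edge_of G (?t x) = edge_of G x"
    using G unfolding ribbon_graph_def pairing_on_def by auto
  note P = segm_eside_commute[OF G p]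
  show ?thesis
  proof (cases "edge_of G c = edge_of G p")
    case True
    then have "c \<in> {p, ?s p, ?t p, ?s (?t p)}" using P(2) c by auto
    moreover have "?t (?s (?t p)) = ?s p"
      using P(1) s t p by metis
    ultimately show ?thesis
      using P(1,3) s[OF p] t[OF p] s[of "?t p"] t[of "?s p"]
      by (auto simp: twist_end_def partial_petrial_def transpose_def)
  next
    case False
    then have "c \<noteq> p" "c \<noteq> ?s p" "?t c \<noteq> p" "?t c \<noteq> ?s p"
      using s[OF p] t[OF c] by auto
    with False show ?thesis
      by (auto simp: twist_end_def partial_petrial_def transpose_def)
  qed
qed

section \<open>The topological transition polynomial\<close>

text \<open>Polynomials over the rationals in the indeterminates \<open>\<alpha>\<^sub>e\<close>, \<open>\<beta>\<^sub>e\<close>, \<open>\<gamma>\<^sub>e\<close> and \<open>t\<close>.\<close>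

datatype 'e indet = Alpha 'e | Beta 'e | Gamma 'e | T

type_synonym 'e polynomial = "('e indet \<Rightarrow>\<^sub>0 nat) \<Rightarrow>\<^sub>0 rat"

definition Var :: "'e indet \<Rightarrow> 'e polynomial" where
  "Var x = Poly_Mapping.single (Poly_Mapping.single x 1) 1"

definition half :: "'e polynomial" where
  "half = Poly_Mapping.single 0 (1 / 2)"

definition ordered_partitions3 :: "'e set \<Rightarrow> ('e set \<times> 'e set \<times> 'e set) set" where
  "ordered_partitions3 E =
     {(X, Y, Z). X \<union> Y \<union> Z = E \<and> X \<inter> Y = {} \<and> X \<inter> Z = {} \<and> Y \<inter> Z = {}}"

definition transition_polynomial :: "('v, 'e, 'c) ribbon_graph \<Rightarrow> 'e polynomial" where
  "transition_polynomial G =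
     (\<Sum>(X, Y, Z)\<in>ordered_partitions3 (edges G).
        (\<Prod>e\<in>X. Var (Alpha e)) * (\<Prod>e\<in>Y. Var (Beta e)) * (\<Prod>e\<in>Z. Var (Gamma e)) *
        Var T ^ num_boundary (delete_edges (partial_petrial G Z) Y))"

definition quasi_tree_partitions :: "('v, 'e, 'c) ribbon_graph \<Rightarrow> ('e set \<times> 'e set \<times> 'e set) set" where
  "quasi_tree_partitions G =
     {(X, Y, Z) \<in> ordered_partitions3 (edges G).
        num_boundary (delete_edges (partial_petrial G Z) Y) = num_components G}"

section \<open>Activities\<close>

text \<open>
  A boundary component of \<open>delete_edges H Y\<close>, seen as a curve in \<open>H\<close>, runs alternately along
  free vertex arcs of \<open>H\<close> and along arcs on the boundary circles of the edge discs: along the sides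
  of the edges outside \<open>Y\<close> and along the segments of the edges in \<open>Y\<close>.  If it
  enters an edge at the corner \<open>c\<close>, it leaves the edge at \<open>across H Y c\<close>.
\<close>

definition across :: "('v, 'e, 'c) ribbon_graph \<Rightarrow> 'e set \<Rightarrow> 'c \<Rightarrow> 'c" where
  "across H Y c = (if edge_of H c \<in> Y then segm H c else eside H c)"

text \<open>
  A directed boundary curve that meets at least one edge, as the cyclic list of the corners at
  which it enters edges; starting point and direction are arbitrary.
\<close>

definition tour :: "('v, 'e, 'c) ribbon_graph \<Rightarrow> 'e set \<Rightarrow> 'c list \<Rightarrow> bool" where
  "tour H Y cs \<longleftrightarrow> cs \<noteq> [] \<and> distinct cs \<and> set cs \<subseteq> corners H \<and>
     (\<forall>i<length cs. varc H (across H Y (cs ! i)) = cs ! (Suc i mod length cs))"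

definition interlaced :: "('v, 'e, 'c) ribbon_graph \<Rightarrow> 'e set \<Rightarrow> 'e \<Rightarrow> 'e \<Rightarrow> bool" where
  "interlaced H Y e f \<longleftrightarrow>
     (\<exists>cs i j k l. tour H Y cs \<and> i < j \<and> j < k \<and> k < l \<and> l < length cs \<and>
        edge_of H (cs ! i) = e \<and> edge_of H (cs ! j) = f \<and>
        edge_of H (cs ! k) = e \<and> edge_of H (cs ! l) = f)"

text \<open>
  An orientation of the edge disc \<open>e\<close>, as the set of the four arcs of its boundary circle, each
  directed from its first to its second corner.
\<close>

definition edge_orientation :: "('v, 'e, 'c) ribbon_graph \<Rightarrow> 'e \<Rightarrow> 'c rel \<Rightarrow> bool" where
  "edge_orientation H e D \<longleftrightarrow>
     (\<exists>c\<in>corners H. edge_of H c = e \<and>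
        (let c1 = segm H c; c2 = eside H c1; c3 = segm H c2
         in D = {(c, c1), (c1, c2), (c2, c3), (c3, c)}))"

text \<open>
  Exactly one of the two arcs in which the curve meets \<open>e\<close> agrees with its direction. Reversing
  the edge or the curve changes the agreement of both arcs, so the choice of the two orientations is
  immaterial.
\<close>

definition nonorientable_edge :: "('v, 'e, 'c) ribbon_graph \<Rightarrow> 'e set \<Rightarrow> 'e \<Rightarrow> bool" where
  "nonorientable_edge H Y e \<longleftrightarrow>
     (\<exists>cs i j D. tour H Y cs \<and> edge_orientation H e D \<and>
        i < j \<and> j < length cs \<and> edge_of H (cs ! i) = e \<and> edge_of H (cs ! j) = e \<and>
        ((cs ! i, across H Y (cs ! i)) \<in> D) \<noteq> ((cs ! j, across H Y (cs ! j)) \<in> D))"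

text \<open>In the following, \<open>(f, e) \<in> prec\<close> means that \<open>f\<close> precedes \<open>e\<close>.\<close>

definition active ::
  "('v, 'e, 'c) ribbon_graph \<Rightarrow> 'e rel \<Rightarrow> 'e set \<times> 'e set \<times> 'e set \<Rightarrow> 'e \<Rightarrow> bool" where
  "active G prec = (\<lambda>(X, Y, Z) e.
     \<not> (\<exists>f\<in>edges G. (f, e) \<in> prec \<and> interlaced (partial_petrial G Z) Y e f))"

definition nonorientable ::
  "('v, 'e, 'c) ribbon_graph \<Rightarrow> 'e set \<times> 'e set \<times> 'e set \<Rightarrow> 'e \<Rightarrow> bool" where
  "nonorientable G = (\<lambda>(X, Y, Z) e. nonorientable_edge (partial_petrial G Z) Y e)"

definition IA ::
  "('v, 'e, 'c) ribbon_graph \<Rightarrow> 'e rel \<Rightarrow> 'e set \<times> 'e set \<times> 'e set \<Rightarrow> 'e set \<Rightarrow> 'e set" where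
  "IA G prec P S = {e \<in> S. \<not> active G prec P e}"

definition AO ::
  "('v, 'e, 'c) ribbon_graph \<Rightarrow> 'e rel \<Rightarrow> 'e set \<times> 'e set \<times> 'e set \<Rightarrow> 'e set \<Rightarrow> 'e set" where
  "AO G prec P S = {e \<in> S. active G prec P e \<and> \<not> nonorientable G P e}"

definition AN ::
  "('v, 'e, 'c) ribbon_graph \<Rightarrow> 'e rel \<Rightarrow> 'e set \<times> 'e set \<times> 'e set \<Rightarrow> 'e set \<Rightarrow> 'e set" where
  "AN G prec P S = {e \<in> S. active G prec P e \<and> nonorientable G P e}"

end

theory Submission
  imports Defs
begin

text \<open>
  A state chooses at every edge one of the three perfect matchings of its four corners, and the
  boundary components are the classes of corners generated by these matchings and the free vertex
  arcs.  Decide the edges from the largest to the smallest.  When \<open>e\<close> is reached (larger edges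
  decided, smaller ones undecided), the rest of the graph meets the corners of \<open>e\<close>, by parity, either
  in one class or in two pairs.  In the first case the choice at \<open>e\<close> does not change the number of
  components.  In the second case exactly one choice \<open>a\<close> creates an additional component, and its
  states have one boundary component more than those with the other two choices; so its
  contribution is \<open>t w\<^sub>a\<close> times that of either of them and can be distributed to them
  in two halves.  In a state with the minimal number of boundary components the second case says
  that \<open>e\<close> is active, and the direction in which the boundary curve passes \<open>e\<close> the second time
  determines \<open>a\<close>.
\<close>

text \<open>An undecided edge glues its four corners together, and deciding it can only separate
  them. So a cut seen at \<open>e\<close> while the smaller edges are undecided persists however
  these are decided, and its type persists too, because parity rules out four corners in four
  different classes. Hence the ratio \<open>t\<close> between the choices at \<open>e\<close> holds
  state by state, for minimal and nonminimal states alike. Deciding the largest edge first is what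
  restricts activity to smaller edges: the two strands of a boundary curve between its visits of
  \<open>e\<close> are joined by an interlaced edge that is still undecided, and by no other edge.
  The obstacle is that the sum speaks of classes of corners while activities speak of tours. The two
  meet in the minimal states: there a curve through one corner of an edge runs through all four, so
  it visits each edge of its component exactly twice.\<close>

section \<open>Parity of sets with a fixed-point-free involution\<close>

lemma even_card_pairing_on:
  assumes "finite A" "pairing_on A f"
  shows "even (card A)"
  using assms
proof (induction A rule: finite_psubset_induct)
  case (psubset A)
  show ?case
  proof (cases "A = {}")
    case False
    then obtain c where c: "c \<in> A" by blast
    let ?B = "A - {c, f c}"
    have f: "f c \<in> A" "f c \<noteq> c" using psubset.prems c unfolding pairing_on_def by auto
    have "pairing_on ?B f"
      unfolding pairing_on_def
    proof
      fix x assume "x \<in> ?B"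
      then have x: "x \<in> A" "x \<noteq> c" "x \<noteq> f c" by auto
      then have fx: "f x \<in> A" "f x \<noteq> x" "f (f x) = x"
        using psubset.prems unfolding pairing_on_def by auto
      have "f (f c) = c" using psubset.prems c unfolding pairing_on_def by auto
      then have "f x \<noteq> f c" using fx(3) x(2) by fastforce
      moreover have "f x \<noteq> c" using fx(3) x(3) by fastforce
      ultimately show "f x \<in> ?B \<and> f x \<noteq> x \<and> f (f x) = x" using fx by simp
    qed
    moreover have "?B \<subset> A" using c by auto
    ultimately have "even (card ?B)" by (intro psubset.IH)
    moreover have "card A = card ?B + 2"
    proof -
      have "card ?B = card A - card {c, f c}"
        using f c by (intro card_Diff_subset) auto
      moreover have "card {c, f c} \<le> card A" using f c psubset.hyps by (intro card_mono) auto
      ultimately show ?thesis using f by simp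
    qed
    ultimately show ?thesis by simp
  qed simp
qed

section \<open>Quotients by equivalence relations\<close>

text \<open>Sending a class of \<open>r\<close> to the class of \<open>s\<close> around it maps the
  finer quotient onto the coarser one.\<close>

lemma card_quotient_mono:
  assumes "equiv UNIV r" "equiv UNIV s" "r \<subseteq> s" "finite A"
  shows "card (A // s) \<le> card (A // r)"
proof -
  have "A // s = (\<lambda>K. s `` K) ` (A // r)"
  proof -
    have "s `` (r `` {x}) = s `` {x}" for x
      using assms(1-3) unfolding equiv_def by (auto dest: transD refl_onD)
    then show ?thesis unfolding quotient_def by auto
  qed
  then show ?thesis
    using card_image_le[of "A // r"] assms(4) by (simp add: quotient_def)
qed

text \<open>The surjection between the quotients is injective when the finite cardinalities agree.
  This is how a state with the minimal number of classes is seen to glue exactly what all matchings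
  together glue.\<close>

lemma card_quotient_eq_imp_eq:
  assumes r: "equiv UNIV r" and s: "equiv UNIV s" and sub: "r \<subseteq> s" and fin: "finite A"
    and card: "card (A // s) = card (A // r)" and x: "x \<in> A" and y: "y \<in> A" and xy: "(x, y) \<in> s"
  shows "(x, y) \<in> r"
proof -
  have img: "s `` (r `` {x}) = s `` {x}" for x
    using r s sub unfolding equiv_def by (auto dest: transD refl_onD)
  have "A // s = (\<lambda>K. s `` K) ` (A // r)"
    unfolding quotient_def using img by auto
  moreover have "finite (A // r)" using fin by (simp add: quotient_def)
  ultimately have "inj_on (\<lambda>K. s `` K) (A // r)"
    using card by (intro eq_card_imp_inj_on) auto
  moreover have "s `` (r `` {x}) = s `` (r `` {y})"
    using equiv_class_eq[OF s xy] img by simp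
  moreover have "r `` {x} \<in> A // r" "r `` {y} \<in> A // r" using x y by (auto intro: quotientI)
  ultimately have "r `` {x} = r `` {y}" by (metis inj_onD)
  then show ?thesis using r by (simp add: eq_equiv_class_iff)
qed

text \<open>The classes of \<open>x\<close> and \<open>y\<close> are replaced by their union
  \<open>?K\<close>, and all other classes survive unchanged.\<close>

lemma card_quotient_merge:
  assumes r: "equiv UNIV r" and fin: "finite A" and x: "x \<in> A" and y: "y \<in> A" and xy: "(x, y) \<notin> r"
  shows "card (A // r) = card (A // (r \<union> r `` {x, y} \<times> r `` {x, y})) + 1"
proof -
  let ?K = "r `` {x, y}" and ?s = "r \<union> r `` {x, y} \<times> r `` {x, y}"
  let ?D = "A // r - {r `` {x}, r `` {y}}"
  have in_K: "z \<in> ?K \<longleftrightarrow> r `` {z} = r `` {x} \<or> r `` {z} = r `` {y}" for z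
  proof -
    have "(a, z) \<in> r \<longleftrightarrow> r `` {z} = r `` {a}" for a
      using eq_equiv_class_iff[OF r, of a z] by auto
    then show ?thesis by blast
  qed
  have cls: "?s `` {z} = (if z \<in> ?K then ?K else r `` {z})" for z
  proof (cases "z \<in> ?K")
    case True
    then have "r `` {z} \<subseteq> ?K" using in_K by auto
    then show ?thesis using True by auto
  qed auto
  have KA: "?K \<in> A // ?s"
  proof -
    have "x \<in> ?K" using r by (auto simp: equiv_def refl_on_def)
    then have "?s `` {x} = ?K" using cls by simp
    then show ?thesis using quotientI[OF x] by metis
  qed
  have "A // ?s = insert ?K ?D"
  proof (intro equalityI subsetI)
    fix B assume "B \<in> A // ?s"
    then obtain z where "z \<in> A" "B = ?s `` {z}" unfolding quotient_def by blast
    then show "B \<in> insert ?K ?D" using cls[of z] in_K[of z] by (auto intro: quotientI)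
  next
    fix B assume B: "B \<in> insert ?K ?D"
    show "B \<in> A // ?s"
    proof (cases "B = ?K")
      case False
      then obtain z where z: "z \<in> A" "B = r `` {z}" "z \<notin> ?K"
        using B in_K unfolding quotient_def by blast
      then have "B = ?s `` {z}" using cls by simp
      then show ?thesis using z(1) by (simp add: quotientI)
    qed (use KA in simp)
  qed
  moreover have "?K \<notin> ?D"
  proof
    assume "?K \<in> ?D"
    then obtain z where z: "?K = r `` {z}" by (auto simp: quotient_def)
    have "x \<in> ?K" "y \<in> ?K" using r by (auto simp: equiv_def refl_on_def)
    then show False using z xy equiv_class_eq_iff[OF r] by (metis Image_singleton_iff equiv_class_eq)
  qed
  moreover have fq: "finite (A // r)" using fin by (simp add: quotient_def)
  moreover have "r `` {x} \<noteq> r `` {y}" using xy r by (simp add: eq_equiv_class_iff)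
  moreover have "r `` {x} \<in> A // r" "r `` {y} \<in> A // r" using x y by (auto intro: quotientI)
  then have "card {r `` {x}, r `` {y}} \<le> card (A // r)" by (intro card_mono fq) auto
  ultimately show ?thesis
    using x y by (simp add: card_Diff_subset quotientI)
qed

lemma funpow_returns:
  assumes "finite A" "inj_on f A" "f ` A \<subseteq> A" "c \<in> A"
  obtains n where "n > 0" "(f ^^ n) c = c"
proof -
  \<comment> \<open>Continuing \<open>f\<close> by the identity outside \<open>A\<close> gives a map
    injective on the whole type, as the library fact on iterates requires.\<close>
  define g where "g x = (if x \<in> A then f x else x)" for x
  have "inj g" using assms(2,3) unfolding g_def inj_on_def by (auto split: if_splits)
  have gf: "(g ^^ n) c = (f ^^ n) c \<and> (f ^^ n) c \<in> A" for n
    using assms(3,4) unfolding g_def by (induction n) auto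
  have "finite {y. \<exists>n. y = (g ^^ n) c}"
    by (rule finite_subset[OF _ assms(1)]) (use gf in auto)
  then obtain n where "n > 0" "(g ^^ n) c = c"
    using funpow_inj_finite[OF \<open>inj g\<close>] by blast
  then show thesis using that gf by metis
qed

section \<open>Transition systems\<close>

text \<open>The blocks \<open>X\<close>, \<open>Y\<close>, \<open>Z\<close> of an ordered partition, in this order.\<close>

datatype state = Keep | Delete | Twist

lemma UNIV_state: "UNIV = {Keep, Delete, Twist}"
  using state.exhaust by auto

instance state :: finite
  by standard (simp add: UNIV_state)

lemma odd_card_state:
  fixes A :: "state set"
  assumes "odd (card A)"
  shows "A = UNIV \<or> (\<exists>a. A = {a})"
proof -
  have 3: "card (UNIV :: state set) = 3" by (simp add: UNIV_state)
  then have "card A \<le> 3" using card_mono[of UNIV A] by simp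
  then have "card A = 1 \<or> card A = 3" using assms by presburger
  then show ?thesis
    using card_1_singletonE[of A] card_eq_UNIV_imp_eq_UNIV[of A] 3 by auto
qed

text \<open>Together with the identity, the three matchings form a Klein four-group:
  \<open>mt_mt\<close> is its multiplication table, and \<open>same_edge\<close> says that it acts
  transitively on the corners of each edge. Vertices are forgotten; only their free arcs remain, as
  \<open>v\<close>.\<close>

locale transition_system =
  fixes C :: "'c set" and ed :: "'c \<Rightarrow> 'e" and v :: "'c \<Rightarrow> 'c" and mt :: "state \<Rightarrow> 'c \<Rightarrow> 'c"
  assumes finite_C: "finite C"
    and pairing_v: "pairing_on C v"
    and pairing_mt: "pairing_on C (mt a)"
    and ed_mt: "c \<in> C \<Longrightarrow> ed (mt a c) = ed c"
    and mt_mt: "c \<in> C \<Longrightarrow> a \<noteq> b \<Longrightarrow> a \<noteq> k \<Longrightarrow> b \<noteq> k \<Longrightarrow> mt a (mt b c) = mt k c"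
    and same_edge: "c \<in> C \<Longrightarrow> d \<in> C \<Longrightarrow> ed d = ed c \<Longrightarrow> d = c \<or> (\<exists>a. d = mt a c)"
begin

lemma v [simp]: "c \<in> C \<Longrightarrow> v c \<in> C" "c \<in> C \<Longrightarrow> v c \<noteq> c" "c \<in> C \<Longrightarrow> v (v c) = c"
  using pairing_v unfolding pairing_on_def by auto

lemma mt [simp]: "c \<in> C \<Longrightarrow> mt a c \<in> C" "c \<in> C \<Longrightarrow> mt a c \<noteq> c" "c \<in> C \<Longrightarrow> mt a (mt a c) = c"
  using pairing_mt[of a] unfolding pairing_on_def by auto

lemma mt_inject [simp]: "c \<in> C \<Longrightarrow> mt a c = mt b c \<longleftrightarrow> a = b"
proof
  assume c: "c \<in> C" and eq: "mt a c = mt b c"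
  obtain d where "d \<noteq> a" "d \<noteq> b" by (metis state.distinct)
  then show "a = b" using mt_mt[OF c, of a b d] mt(3)[OF c, of a] mt(2)[OF c, of d] eq by metis
qed simp

text \<open>Edges carry sets of matchings so that one relation covers every stage: a singleton is a
  decided edge, \<open>UNIV\<close> glues all four corners of an undecided edge, and the empty set
  removes the edge from consideration. Corners outside \<open>C\<close> are related only to
  themselves, which makes this an equivalence on the whole type.\<close>

definition glued :: "('e \<Rightarrow> state set) \<Rightarrow> 'c rel" where
  "glued M = ({(c, v c) | c. c \<in> C} \<union> {(c, mt a c) | a c. c \<in> C \<and> a \<in> M (ed c)})\<^sup>*"

lemma glued_v: "c \<in> C \<Longrightarrow> (c, v c) \<in> glued M"
  unfolding glued_def by blast

lemma glued_mt: "c \<in> C \<Longrightarrow> a \<in> M (ed c) \<Longrightarrow> (c, mt a c) \<in> glued M"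
  unfolding glued_def by blast

lemma glued_induct [consumes 1, case_names refl v mt]:
  assumes "(x, y) \<in> glued M"
    and "P x"
    and "\<And>c. (x, c) \<in> glued M \<Longrightarrow> c \<in> C \<Longrightarrow> P c \<Longrightarrow> P (v c)"
    and "\<And>c a. (x, c) \<in> glued M \<Longrightarrow> c \<in> C \<Longrightarrow> a \<in> M (ed c) \<Longrightarrow> P c \<Longrightarrow> P (mt a c)"
  shows "P y"
  using assms(1) unfolding glued_def
proof (induction rule: rtrancl_induct)
  case (step y z)
  then show ?case using assms(3,4) unfolding glued_def by blast
qed (rule assms(2))

lemma equiv_glued: "equiv UNIV (glued M)"
proof (rule equivI)
  have "sym ({(c, v c) | c. c \<in> C} \<union> {(c, mt a c) | a c. c \<in> C \<and> a \<in> M (ed c)})"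
    by (rule symI) (auto, (metis v mt ed_mt)+)
  then show "sym (glued M)" unfolding glued_def by (rule sym_rtrancl)
qed (auto simp: glued_def refl_rtrancl trans_rtrancl)

lemma glued_refl [simp]: "(x, x) \<in> glued M"
  unfolding glued_def by simp

lemma glued_sym: "(x, y) \<in> glued M \<Longrightarrow> (y, x) \<in> glued M"
  using equiv_glued by (meson equivE symD)

lemma glued_trans: "(x, y) \<in> glued M \<Longrightarrow> (y, z) \<in> glued M \<Longrightarrow> (x, z) \<in> glued M"
  using equiv_glued by (meson equivE transD)

lemma glued_in_C: "(x, y) \<in> glued M \<Longrightarrow> x \<in> C \<Longrightarrow> y \<in> C"
  by (induction rule: glued_induct) auto

lemma glued_mono:
  assumes "\<And>c. c \<in> C \<Longrightarrow> M (ed c) \<subseteq> N (ed c)"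
  shows "glued M \<subseteq> glued N"
  unfolding glued_def using assms by (intro rtrancl_mono) blast

lemma glued_cong:
  assumes "\<And>c. c \<in> C \<Longrightarrow> M (ed c) = N (ed c)"
  shows "glued M = glued N"
  using glued_mono[of M N] glued_mono[of N M] assms by auto

definition num_glued :: "('e \<Rightarrow> state set) \<Rightarrow> nat" where
  "num_glued M = card (C // glued M)"

text \<open>Meant for \<open>M e = {}\<close>: then \<open>a\<close> is the state at \<open>e\<close> that creates an additional component.\<close>

definition cut_type :: "('e \<Rightarrow> state set) \<Rightarrow> 'e \<Rightarrow> state \<Rightarrow> bool" where
  "cut_type M e a \<longleftrightarrow> (\<forall>c\<in>C. ed c = e \<longrightarrow> (\<forall>b. (c, mt b c) \<in> glued M \<longleftrightarrow> b = a))"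

text \<open>Parity: a class is paired off by \<open>v\<close>, and its corners outside \<open>e\<close> are paired off as well.\<close>

lemma glued_states_at:
  assumes e: "M e = {}" and M: "\<And>f. f \<noteq> e \<Longrightarrow> M f \<noteq> {}" and c: "c \<in> C" "ed c = e"
  shows "(\<forall>b. (c, mt b c) \<in> glued M) \<or> (\<exists>a. \<forall>b. (c, mt b c) \<in> glued M \<longleftrightarrow> b = a)"
proof -
  let ?K = "glued M `` {c}" and ?A = "{b. (c, mt b c) \<in> glued M}"
  let ?E = "{d. ed d = e}"
  \<comment> \<open>Away from \<open>e\<close> some matching is allowed at every edge; following a
    chosen one stays in the class and pairs off its corners outside \<open>e\<close>.\<close>
  define g where "g x = mt (SOME a. a \<in> M (ed x)) x" for x
  have KC: "?K \<subseteq> C" using c glued_in_C by blast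
  then have fin: "finite ?K" using finite_C finite_subset by blast
  have "pairing_on ?K v"
    unfolding pairing_on_def using KC by (auto intro: glued_trans glued_v)
  then have "even (card ?K)" using even_card_pairing_on fin by blast
  moreover have "pairing_on (?K - ?E) g"
    unfolding pairing_on_def
  proof
    fix x assume x: "x \<in> ?K - ?E"
    then have xC: "x \<in> C" using KC by blast
    have "(SOME a. a \<in> M (ed x)) \<in> M (ed x)" using M[of "ed x"] x by (simp add: some_in_eq)
    then have "(x, g x) \<in> glued M" unfolding g_def using glued_mt xC by blast
    moreover have "ed (g x) = ed x" unfolding g_def using ed_mt xC by simp
    moreover have "g (g x) = x" "g x \<noteq> x" unfolding g_def using xC by (auto simp: ed_mt)
    ultimately show "g x \<in> ?K - ?E \<and> g x \<noteq> x \<and> g (g x) = x"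
      using x by (auto intro: glued_trans)
  qed
  then have "even (card (?K - ?E))" using even_card_pairing_on fin by blast
  moreover have "card ?K = card (?K - ?E) + card (?K \<inter> ?E)"
    using fin by (metis Int_Diff_Un Int_Diff_disjoint add.commute card_Un_disjoint finite_Diff finite_Int)
  \<comment> \<open>The corners of \<open>e\<close> in the class are \<open>c\<close> and its
    partners. Their number is even, so the number of partners is odd: one or three.\<close>
  moreover have "?K \<inter> ?E = insert c ((\<lambda>b. mt b c) ` ?A)"
    using same_edge[OF c(1)] c KC by (auto simp: ed_mt)
  moreover have "card (insert c ((\<lambda>b. mt b c) ` ?A)) = Suc (card ?A)"
  proof -
    have "card ((\<lambda>b. mt b c) ` ?A) = card ?A" using c by (intro card_image inj_onI) simp
    moreover have "c \<notin> (\<lambda>b. mt b c) ` ?A" using c mt(2) by (metis imageE)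
    ultimately show ?thesis by (simp add: card_insert_if)
  qed
  ultimately have odd: "odd (card ?A)" by simp
  then have "?A = UNIV \<or> (\<exists>a. ?A = {a})" by (rule odd_card_state)
  then show ?thesis
    by (metis (mono_tags, lifting) UNIV_I mem_Collect_eq singleton_iff)
qed

section \<open>Cuts at a single edge\<close>

text \<open>Parity settles each corner separately. If one corner \<open>c\<close> has a single
  partner \<open>mt a c\<close>, the group law carries the same type \<open>a\<close> to the other
  three corners.\<close>

lemma cut_type_dichotomy:
  assumes e: "M e = {}" and M: "\<And>f. f \<noteq> e \<Longrightarrow> M f \<noteq> {}"
  shows "(\<forall>c\<in>C. \<forall>d\<in>C. ed c = e \<longrightarrow> ed d = e \<longrightarrow> (c, d) \<in> glued M) \<or> (\<exists>a. cut_type M e a)"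
proof (cases "\<forall>c\<in>C. ed c = e \<longrightarrow> (\<forall>b. (c, mt b c) \<in> glued M)")
  case True
  then show ?thesis using same_edge by (metis glued_refl)
next
  case False
  then obtain c where c: "c \<in> C" "ed c = e" "\<not> (\<forall>b. (c, mt b c) \<in> glued M)" by blast
  then obtain a where a: "\<And>b. (c, mt b c) \<in> glued M \<longleftrightarrow> b = a"
    using glued_states_at[of M e, OF e M c(1,2)] c(3) by blast
  have "cut_type M e a" unfolding cut_type_def
  proof (intro ballI impI)
    fix x assume x: "x \<in> C" "ed x = e"
    then consider "x = c" | "x = mt a c" | b where "b \<noteq> a" "x = mt b c"
      using same_edge[OF c(1) x(1)] c(2) by metis
    then show "\<forall>b. (x, mt b x) \<in> glued M \<longleftrightarrow> b = a"
    proof cases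
      case 1
      then show ?thesis using a by blast
    next
      case 2
      have cx: "(c, x) \<in> glued M" using a 2 by simp
      have "(x, mt b x) \<notin> glued M" if "b \<noteq> a" for b
      proof -
        obtain d where "d \<noteq> a" "d \<noteq> b" by (metis state.distinct)
        then have "mt b x = mt d c" using 2 mt_mt c that by metis
        then show ?thesis using a[of d] \<open>d \<noteq> a\<close> cx glued_trans by metis
      qed
      moreover have "(x, mt a x) \<in> glued M" using 2 cx c glued_sym by simp
      ultimately show ?thesis by blast
    next
      case 3
      \<comment> \<open>Here \<open>x\<close> lies in the other pair: its partners under
        \<open>b\<close> and \<open>d\<close> are \<open>c\<close> and \<open>mt a c\<close>, both
        in the class of \<open>c\<close>. By parity \<open>x\<close> still has a partner, and only
        \<open>a\<close> is left.\<close>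
      obtain d where d: "d \<noteq> a" "d \<noteq> b" by (metis state.distinct)
      have cx: "(x, c) \<notin> glued M" using a[of b] 3 glued_sym by blast
      then have b: "(x, mt b x) \<notin> glued M" using 3 c by simp
      have "mt d x = mt a c" using mt_mt[OF c(1), of d b a] 3 d by simp
      then have dx: "(x, mt d x) \<notin> glued M" using cx a[of a] glued_trans glued_sym by metis
      obtain q where q: "\<forall>p. (x, mt p x) \<in> glued M \<longleftrightarrow> p = q"
        using glued_states_at[of M e, OF e M x] b by blast
      then have "q \<noteq> b" "q \<noteq> d" using b dx by auto
      then have "q = a" using d 3(1) by (cases a; cases b; cases d; cases q) auto
      then show ?thesis using q by simp
    qed
  qed
  then show ?thesis by blast
qed

lemma glued_update_connected:
  assumes "M e = {}" "\<forall>c\<in>C. \<forall>d\<in>C. ed c = e \<longrightarrow> ed d = e \<longrightarrow> (c, d) \<in> glued M"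
  shows "glued (M(e := S)) = glued M"
proof
  show "glued (M(e := S)) \<subseteq> glued M"
  proof clarify
    fix x y assume "(x, y) \<in> glued (M(e := S))"
    then show "(x, y) \<in> glued M"
    proof (induction rule: glued_induct)
      case (v c)
      then show ?case using glued_v glued_trans by blast
    next
      case (mt c a)
      then have "(c, mt a c) \<in> glued M" using assms(2) glued_mt
        by (cases "ed c = e") (auto simp: ed_mt)
      then show ?case using mt glued_trans by blast
    qed simp
  qed
qed (rule glued_mono, use assms(1) in auto)

lemma glued_update_same:
  assumes "M e = {}" "cut_type M e a"
  shows "glued (M(e := {a})) = glued M"
proof
  show "glued (M(e := {a})) \<subseteq> glued M"
  proof clarify
    fix x y assume "(x, y) \<in> glued (M(e := {a}))"
    then show "(x, y) \<in> glued M"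
    proof (induction rule: glued_induct)
      case (v c)
      then show ?case using glued_v glued_trans by blast
    next
      case (mt c b)
      then have "(c, mt b c) \<in> glued M" using assms(2) glued_mt unfolding cut_type_def
        by (cases "ed c = e") (auto simp: ed_mt)
      then show ?case using mt glued_trans by blast
    qed simp
  qed
qed (rule glued_mono, use assms(1) in auto)

text \<open>With a cut of type \<open>a\<close>, the corners of \<open>e\<close> lie in two classes,
  those of \<open>c\<close> and \<open>mt b c\<close>; any matching other than \<open>a\<close>
  joins them. The set \<open>S\<close> is kept general so that both a decision \<open>{b}\<close>
  and the undecided \<open>UNIV\<close> are covered.\<close>

lemma num_glued_update_merge:
  assumes e: "M e = {}" and a: "cut_type M e a" and S: "b \<in> S" "b \<noteq> a" and c: "c \<in> C" "ed c = e"
  shows "num_glued M = num_glued (M(e := S)) + 1"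
proof -
  let ?r = "glued M" and ?s = "glued (M(e := S))"
  let ?K = "?r `` {c, mt b c}"
  have cb: "mt b c \<in> C" "ed (mt b c) = e" using c ed_mt by auto
  have K: "x \<in> ?K" if x: "x \<in> C" "ed x = e" for x
  proof -
    consider "x = c" | "x = mt a c" | "x = mt b c" | d where "x = mt d c" "d \<noteq> a" "d \<noteq> b"
      using same_edge[OF c(1) x(1)] x c by metis
    then show ?thesis
    proof cases
      case 1
      then show ?thesis using glued_refl by blast
    next
      case 2
      then show ?thesis using a c unfolding cut_type_def by blast
    next
      case 3
      then show ?thesis using glued_refl by blast
    next
      case 4
      then have "x = mt a (mt b c)" using mt_mt[OF c(1), of a b d] S by simp
      then show ?thesis using a cb unfolding cut_type_def by blast
    qed
  qed
  have rs: "?r \<subseteq> ?s" using e by (intro glued_mono) auto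
  have "?s = ?r \<union> ?K \<times> ?K"
  proof (intro equalityI subrelI)
    fix x y assume "(x, y) \<in> ?s"
    then show "(x, y) \<in> ?r \<union> ?K \<times> ?K"
    proof (induction rule: glued_induct)
      case (v d)
      then show ?case using glued_v[of d M] by (auto intro: glued_trans)
    next
      case (mt d q)
      show ?case
      proof (cases "ed d = e")
        case True
        have "d \<in> ?K" "mt q d \<in> ?K" using K mt(2) True by (auto simp: ed_mt)
        moreover have "x \<in> ?K"
        proof (cases "(x, d) \<in> ?r")
          case True
          then show ?thesis using \<open>d \<in> ?K\<close> by (auto intro: glued_trans glued_sym)
        qed (use mt in auto)
        ultimately show ?thesis by blast
      next
        case False
        then have "(d, mt q d) \<in> ?r" using mt glued_mt by simp
        then show ?thesis using mt by (auto intro: glued_trans)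
      qed
    qed simp
  next
    fix x y assume xy: "(x, y) \<in> ?r \<union> ?K \<times> ?K"
    have cs: "(c, z) \<in> ?s" if "z \<in> ?K" for z
    proof -
      have "(c, mt b c) \<in> ?s" using c S by (intro glued_mt) auto
      then show ?thesis using that rs glued_trans by blast
    qed
    show "(x, y) \<in> ?s"
    proof (cases "(x, y) \<in> ?r")
      case False
      then have "x \<in> ?K" "y \<in> ?K" using xy by auto
      then show ?thesis using cs glued_sym glued_trans by metis
    qed (use rs in blast)
  qed
  moreover have "(c, mt b c) \<notin> ?r" using a c S unfolding cut_type_def by blast
  ultimately show ?thesis
    unfolding num_glued_def
    using card_quotient_merge[OF equiv_glued finite_C c(1) cb(1)] by simp
qed

lemma num_glued_mono:
  assumes "\<And>c. c \<in> C \<Longrightarrow> M (ed c) \<subseteq> N (ed c)"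
  shows "num_glued N \<le> num_glued M"
  unfolding num_glued_def
  by (rule card_quotient_mono[OF equiv_glued equiv_glued glued_mono finite_C]) (rule assms)

text \<open>By parity, gluing more corners leaves the type of a cut unchanged as long as it stays a cut.\<close>

lemma cut_type_anti_mono:
  assumes a: "cut_type N e a" and sub: "\<And>c. c \<in> C \<Longrightarrow> M (ed c) \<subseteq> N (ed c)"
    and e: "M e = {}" and M: "\<And>f. f \<noteq> e \<Longrightarrow> M f \<noteq> {}"
  shows "cut_type M e a"
  unfolding cut_type_def
proof (intro ballI impI)
  fix c assume c: "c \<in> C" "ed c = e"
  have "(c, mt b c) \<notin> glued M" if "b \<noteq> a" for b
  proof -
    have "glued M \<subseteq> glued N" using sub by (rule glued_mono)
    then show ?thesis using a c that unfolding cut_type_def by blast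
  qed
  \<comment> \<open>A single missing partner excludes the connected case, so parity leaves exactly
    one partner, and all but \<open>a\<close> are excluded.\<close>
  moreover obtain b where "b \<noteq> a" by (metis state.distinct)
  ultimately show "\<forall>b. (c, mt b c) \<in> glued M \<longleftrightarrow> b = a"
    using glued_states_at[of M e, OF e M c] by metis
qed

lemma cut_type_unique:
  assumes "cut_type M e a" "cut_type M e b" "c \<in> C" "ed c = e"
  shows "a = b"
  using assms unfolding cut_type_def by blast

section \<open>The state sum\<close>

text \<open>The states that extend the decisions of \<open>s\<close> made outside \<open>U\<close>.
  Fixing values outside \<open>U\<close> keeps this set finite although states are total
  functions.\<close>

definition agree :: "('e \<Rightarrow> state) \<Rightarrow> 'e set \<Rightarrow> ('e \<Rightarrow> state) set" where
  "agree s U = {\<sigma>. \<forall>f. f \<notin> U \<longrightarrow> \<sigma> f = s f}"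

definition decided :: "('e \<Rightarrow> state) \<Rightarrow> 'e \<Rightarrow> state set" where
  "decided \<sigma> = (\<lambda>f. {\<sigma> f})"

definition undecided :: "('e \<Rightarrow> state) \<Rightarrow> 'e set \<Rightarrow> 'e \<Rightarrow> state set" where
  "undecided s U = (\<lambda>f. if f \<in> U then UNIV else {s f})"

text \<open>The edge \<open>e\<close> itself gets the empty set, so that the relation shows only how
  the rest of the graph connects its corners.\<close>

definition beneath :: "'e rel \<Rightarrow> ('e \<Rightarrow> state) \<Rightarrow> 'e \<Rightarrow> 'e \<Rightarrow> state set" where
  "beneath r \<sigma> e = (\<lambda>f. if f = e then {} else if (f, e) \<in> r then UNIV else {\<sigma> f})"

text \<open>The sum has at most one term.\<close>

definition activity_weight ::
  "('e \<Rightarrow> state \<Rightarrow> 'r::comm_ring_1) \<Rightarrow> 'r \<Rightarrow> 'e rel \<Rightarrow> ('e \<Rightarrow> state) \<Rightarrow> 'e \<Rightarrow> 'r" where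
  "activity_weight w u r \<sigma> e =
     w e (\<sigma> e) + (\<Sum>a | cut_type (beneath r \<sigma> e) e a. u * w e a)"

lemma agree_empty [simp]: "agree s {} = {s}"
  unfolding agree_def by auto

lemma agree_insert: "agree s (insert e U) = (\<Union>a. agree (s(e := a)) U)"
  unfolding agree_def by auto

lemma finite_agree: "finite U \<Longrightarrow> finite (agree s U)"
  by (induction U arbitrary: s rule: finite_induct) (auto simp: agree_insert)

lemma agree_at: "\<sigma> \<in> agree (s(e := a)) U \<Longrightarrow> e \<notin> U \<Longrightarrow> \<sigma> e = a"
  unfolding agree_def by auto

lemma sum_agree_insert:
  assumes "finite U" "e \<notin> U"
  shows "(\<Sum>\<sigma>\<in>agree s (insert e U). F \<sigma>) = (\<Sum>a\<in>UNIV. \<Sum>\<sigma>\<in>agree (s(e := a)) U. F \<sigma>)"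
  unfolding agree_insert
proof (rule sum.UNION_disjoint)
  show "\<forall>a\<in>UNIV. \<forall>b\<in>UNIV. a \<noteq> b \<longrightarrow> agree (s(e := a)) U \<inter> agree (s(e := b)) U = {}"
    using assms(2) agree_at by blast
qed (use assms(1) finite_agree in auto)

lemma cut_type_singleton:
  assumes "cut_type M e a" "c \<in> C" "ed c = e"
  shows "{b. cut_type M e b} = {a}"
  using assms cut_type_unique by blast

text \<open>Induction on the undecided set, removing its largest edge. To make this work,
  \<open>s\<close> carries arbitrary decisions outside \<open>U\<close>, and minimality is measured
  against \<open>undecided s U\<close> instead of the whole graph. Down-closedness of
  \<open>U\<close> ensures that the edges below \<open>e\<close> are exactly those still
  undecided.\<close>

theorem state_sum_eq_activity_sum:
  fixes w :: "'e \<Rightarrow> state \<Rightarrow> 'r::comm_ring_1"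
  assumes h: "h + h = 1"
    and fin: "finite U" and lin: "trans r" "irrefl r" "total_on U r"
    and down: "\<And>f g. f \<in> U \<Longrightarrow> (g, f) \<in> r \<Longrightarrow> g \<in> U"
    and corner: "\<And>f. f \<in> U \<Longrightarrow> \<exists>c\<in>C. ed c = f"
  shows "(\<Sum>\<sigma>\<in>agree s U. (\<Prod>f\<in>U. w f (\<sigma> f)) * t ^ num_glued (decided \<sigma>)) =
    t ^ num_glued (undecided s U) *
    (\<Sum>\<sigma>\<in>agree s U. if num_glued (decided \<sigma>) = num_glued (undecided s U)
       then \<Prod>f\<in>U. activity_weight w (h * t) r \<sigma> f else 0)"
  using fin lin(3) down corner
proof (induction U arbitrary: s rule: finite_psubset_induct)
  case (psubset U)
  define W where "W U \<sigma> = (\<Prod>f\<in>U. w f (\<sigma> f)) * t ^ num_glued (decided \<sigma>)" for U \<sigma>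
  define A where "A \<sigma> f = activity_weight w (h * t) r \<sigma> f" for \<sigma> f
  define T where "T U s = (\<Sum>\<sigma>\<in>agree s U. if num_glued (decided \<sigma>) = num_glued (undecided s U)
     then \<Prod>f\<in>U. A \<sigma> f else 0)" for U s
  show ?case
  proof (cases "U = {}")
    case True
    then show ?thesis by (simp add: undecided_def decided_def)
  next
    case False
    have "asymp_on U (\<lambda>x y. (x, y) \<in> r)" "transp_on U (\<lambda>x y. (x, y) \<in> r)"
      using lin(1,2) unfolding asymp_on_def transp_on_def irrefl_def by (blast dest: transD)+
    then have "\<exists>m\<in>U. \<forall>x\<in>U. x \<noteq> m \<longrightarrow> (m, x) \<notin> r"
      using Finite_Set.bex_max_element psubset.hyps(1) False by blast
    then obtain e where e: "e \<in> U" "\<And>x. x \<in> U \<Longrightarrow> x \<noteq> e \<Longrightarrow> (e, x) \<notin> r" by blast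
    define V where "V = U - {e}"
    have V: "U = insert e V" "e \<notin> V" "finite V" "V \<subset> U" using e psubset.hyps(1) V_def by auto
    have le_e: "(f, e) \<in> r \<longleftrightarrow> f \<in> V" for f
      using e psubset.prems(1,2) lin(2) unfolding V_def total_on_def irrefl_def by blast
    have IH: "(\<Sum>\<sigma>\<in>agree s V. W V \<sigma>) = t ^ num_glued (undecided s V) * T V s" for s
      unfolding W_def A_def T_def
    proof (rule psubset.IH)
      show "total_on V r" using psubset.prems(1) V(1) unfolding total_on_def by blast
      show "g \<in> V" if "f \<in> V" "(g, f) \<in> r" for f g
        using that psubset.prems(2)[of f g] e(2)[of f] V by auto
    qed (use V psubset.prems(3) in auto)
    \<comment> \<open>The gluing at the moment when \<open>e\<close> is decided; \<open>M_U\<close>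
      and \<open>M_a\<close> describe the gluings just before and just after the decision.\<close>
    define M where "M = (\<lambda>f. if f = e then {} else undecided s V f)"
    have Me: "M e = {}" "\<And>f. f \<noteq> e \<Longrightarrow> M f \<noteq> {}" unfolding M_def undecided_def by auto
    have M_U: "undecided s U = M(e := UNIV)"
      unfolding M_def undecided_def using V by (auto simp: fun_eq_iff)
    have M_a: "undecided (s(e := a)) V = M(e := {a})" for a
      unfolding M_def undecided_def using V by (auto simp: fun_eq_iff)
    \<comment> \<open>The cut at \<open>e\<close> depends only on decisions already made, so it is
      common to all states of the branch and the factor at \<open>e\<close> can be pulled out of the
      sum.\<close>
    have M_beneath: "beneath r \<sigma> e = M" if "\<sigma> \<in> agree (s(e := a)) V" for \<sigma> a
      using that unfolding M_def undecided_def beneath_def agree_def by (auto simp: le_e fun_eq_iff)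
    obtain c where c: "c \<in> C" "ed c = e" using psubset.prems(3) e(1) by blast
    let ?k = "num_glued (undecided s U)"
    define F where "F a = (\<Sum>\<sigma>\<in>agree (s(e := a)) V. W V \<sigma>)" for a
    have F: "(\<Sum>\<sigma>\<in>agree s U. W U \<sigma>) = (\<Sum>a\<in>UNIV. w e a * F a)"
    proof -
      have "(\<Sum>\<sigma>\<in>agree s U. W U \<sigma>) = (\<Sum>a\<in>UNIV. \<Sum>\<sigma>\<in>agree (s(e := a)) V. W U \<sigma>)"
        unfolding V(1) using V(2,3) by (rule sum_agree_insert[rotated])
      also have "\<dots> = (\<Sum>a\<in>UNIV. \<Sum>\<sigma>\<in>agree (s(e := a)) V. w e a * W V \<sigma>)"
        unfolding W_def V(1) using V(2,3) by (intro sum.cong refl) (auto simp: agree_at mult.assoc)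
      finally show ?thesis unfolding F_def by (simp add: sum_distrib_left)
    qed
    define S where "S a = (\<Sum>\<sigma>\<in>agree (s(e := a)) V.
      if num_glued (decided \<sigma>) = ?k then A \<sigma> e * (\<Prod>f\<in>V. A \<sigma> f) else 0)" for a
    have S: "T U s = (\<Sum>a\<in>UNIV. S a)"
    proof -
      have "T U s = (\<Sum>a\<in>UNIV. \<Sum>\<sigma>\<in>agree (s(e := a)) V.
          if num_glued (decided \<sigma>) = ?k then \<Prod>f\<in>U. A \<sigma> f else 0)"
        unfolding T_def V(1) using V(2,3) by (rule sum_agree_insert[rotated])
      then show ?thesis unfolding S_def V(1) using V(2,3) by (simp cong: if_cong)
    qed
    have S_eq: "S a = (w e a + x) * T V (s(e := a))"
      if "num_glued (M(e := {a})) = ?k" and x: "(\<Sum>b | cut_type M e b. h * t * w e b) = x" for a x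
    proof -
      have "A \<sigma> e = w e a + x" if "\<sigma> \<in> agree (s(e := a)) V" for \<sigma>
        using that x V(2) unfolding A_def activity_weight_def by (simp add: M_beneath agree_at)
      then show ?thesis
        unfolding S_def T_def M_a that(1) sum_distrib_left by (intro sum.cong refl) auto
    qed
    have tT: "t ^ ?k * T V (s(e := a)) = F a" if "num_glued (M(e := {a})) = ?k" for a
      using IH[of "s(e := a)"] that unfolding F_def M_a by simp
    have "(\<Sum>a\<in>UNIV. w e a * F a) = t ^ ?k * (\<Sum>a\<in>UNIV. S a)"
    proof (cases "\<exists>a. cut_type M e a")
      case False
      then have con: "\<forall>c\<in>C. \<forall>d\<in>C. ed c = e \<longrightarrow> ed d = e \<longrightarrow> (c, d) \<in> glued M"
        using cut_type_dichotomy[of M e, OF Me] by blast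
      \<comment> \<open>In the connected case every choice leaves the gluing as it is, so all three
        branches keep the target number \<open>?k\<close>.\<close>
      have k: "num_glued (M(e := {a})) = ?k" for a
        unfolding M_U num_glued_def by (simp add: glued_update_connected[OF Me(1) con])
      have "S a = (w e a + 0) * T V (s(e := a))" for a
        using False by (intro S_eq k) simp
      then have "t ^ ?k * S a = w e a * F a" for a
        using tT[OF k, of a] by (simp add: mult.left_commute)
      then show ?thesis by (simp add: sum_distrib_left)
    next
      case True
      then obtain p where p: "cut_type M e p" by blast
      then have only_p: "{b. cut_type M e b} = {p}" using cut_type_singleton c by blast
      obtain q q' where q: "q \<noteq> p" "q' \<noteq> p" "q \<noteq> q'" by (metis state.distinct)
      then have UN: "UNIV = {p, q, q'}" using UNIV_state by (cases p; cases q; cases q') auto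
      \<comment> \<open>Choosing \<open>p\<close> leaves the two classes at \<open>e\<close> apart,
        while \<open>UNIV\<close> merges them.\<close>
      have kp: "num_glued (M(e := {p})) = ?k + 1"
        using num_glued_update_merge[of M e p q UNIV, OF Me(1) p _ q(1) c] glued_update_same[OF Me(1) p]
        unfolding M_U num_glued_def by simp
      have k: "num_glued (M(e := {a})) = ?k" if "a \<noteq> p" for a
        using num_glued_update_merge[of M e p a UNIV, OF Me(1) p _ that c]
          num_glued_update_merge[of M e p a "{a}", OF Me(1) p _ that c]
        unfolding M_U by simp
      \<comment> \<open>Further decisions only separate classes, so no state of the \<open>p\<close>
        branch comes down to \<open>?k\<close>.\<close>
      have Sp: "S p = 0"
        unfolding S_def
      proof (intro sum.neutral ballI)
        fix \<sigma> assume "\<sigma> \<in> agree (s(e := p)) V"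
        then have "num_glued (undecided (s(e := p)) V) \<le> num_glued (decided \<sigma>)"
          by (intro num_glued_mono) (auto simp: undecided_def decided_def agree_def)
        then show "(if num_glued (decided \<sigma>) = ?k then A \<sigma> e * (\<Prod>f\<in>V. A \<sigma> f) else 0) = 0"
          unfolding M_a kp by simp
      qed
      have Sa: "t ^ ?k * S a = (w e a + h * t * w e p) * F a" if "a \<noteq> p" for a
      proof -
        have "S a = (w e a + h * t * w e p) * T V (s(e := a))"
          by (rule S_eq[OF k[OF that]]) (simp add: only_p)
        then show ?thesis
          unfolding tT[OF k[OF that], symmetric] by (simp only: mult.left_commute)
      qed
      \<comment> \<open>Resetting the state at \<open>e\<close> is a bijection between the two
        branches, and the factor \<open>t\<close> appears term by term.\<close>
      have "F p = t * F a" if "a \<noteq> p" for a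
      proof -
        have "F p = (\<Sum>\<sigma>\<in>agree (s(e := a)) V. W V (\<sigma>(e := p)))"
          unfolding F_def
          by (rule sum.reindex_bij_witness[of _ "\<lambda>\<sigma>. \<sigma>(e := p)" "\<lambda>\<sigma>. \<sigma>(e := a)"])
            (use V(2) in \<open>auto simp: agree_def fun_upd_idem fun_eq_iff\<close>)
        also have "\<dots> = (\<Sum>\<sigma>\<in>agree (s(e := a)) V. t * W V \<sigma>)"
        proof (intro sum.cong refl)
          fix \<sigma> assume \<sigma>: "\<sigma> \<in> agree (s(e := a)) V"
          \<comment> \<open>All edges but \<open>e\<close> are now decided. The cut seen in
            \<open>M\<close> persists in this finer gluing with the same type.\<close>
          let ?N = "(decided \<sigma>)(e := {})"
          have N: "cut_type ?N e p"
            by (rule cut_type_anti_mono[OF p])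
              (use \<sigma> in \<open>auto simp: M_def undecided_def decided_def agree_def\<close>)
          have "decided (\<sigma>(e := p)) = ?N(e := {p})" "decided \<sigma> = ?N(e := {a})"
            using agree_at[OF \<sigma> V(2)] unfolding decided_def by (auto simp: fun_eq_iff)
          then have "num_glued (decided (\<sigma>(e := p))) = num_glued (decided \<sigma>) + 1"
            using num_glued_update_merge[of ?N e p a "{a}", OF _ N _ that c] glued_update_same[OF _ N]
            unfolding num_glued_def by simp
          moreover have "(\<Prod>f\<in>V. w f ((\<sigma>(e := p)) f)) = (\<Prod>f\<in>V. w f (\<sigma> f))"
            using V(2) by (intro prod.cong refl) auto
          ultimately show "W V (\<sigma>(e := p)) = t * W V \<sigma>"
            unfolding W_def by (simp add: algebra_simps)
        qed
        finally show ?thesis unfolding F_def by (simp add: sum_distrib_left)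
      qed
      then have Fp: "F p = t * F q" "F p = t * F q'" using q by blast+
      \<comment> \<open>The \<open>p\<close> branch equals \<open>t\<close> times either other
        branch; half of it is expressed through each.\<close>
      have "F p = h * (t * F q) + h * (t * F q')"
        using h Fp by (metis distrib_right mult_1)
      then have "w e p * F p = h * t * w e p * F q + h * t * w e p * F q'"
        by (simp add: algebra_simps)
      then show ?thesis
        unfolding UN sum_distrib_left using q Sp Sa[OF q(1)] Sa[OF q(2)] by (simp add: algebra_simps)
    qed
    then show ?thesis using F S unfolding W_def T_def A_def by simp
  qed
qed

section \<open>Boundary curves\<close>

definition cross :: "('e \<Rightarrow> state) \<Rightarrow> 'c \<Rightarrow> 'c" where
  "cross \<sigma> c = mt (\<sigma> (ed c)) c"

text \<open>The counterpart of \<open>tour\<close>: the list holds the corners of entry, and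
  \<open>cross\<close> leads to the corners of exit.\<close>

definition curve :: "('e \<Rightarrow> state) \<Rightarrow> 'c list \<Rightarrow> bool" where
  "curve \<sigma> cs \<longleftrightarrow> cs \<noteq> [] \<and> distinct cs \<and> set cs \<subseteq> C \<and>
     (\<forall>i<length cs. v (cross \<sigma> (cs ! i)) = cs ! (Suc i mod length cs))"

lemma cross [simp]:
  "c \<in> C \<Longrightarrow> cross \<sigma> c \<in> C" "c \<in> C \<Longrightarrow> cross \<sigma> c \<noteq> c"
  "c \<in> C \<Longrightarrow> cross \<sigma> (cross \<sigma> c) = c" "c \<in> C \<Longrightarrow> ed (cross \<sigma> c) = ed c"
  unfolding cross_def by (auto simp: ed_mt)

lemma curve_in_C: "curve \<sigma> cs \<Longrightarrow> i < length cs \<Longrightarrow> cs ! i \<in> C"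
  unfolding curve_def by auto

lemma curve_step:
  assumes "curve \<sigma> cs" "Suc i < length cs"
  shows "v (cross \<sigma> (cs ! i)) = cs ! Suc i" "v (cs ! Suc i) = cross \<sigma> (cs ! i)"
proof -
  show *: "v (cross \<sigma> (cs ! i)) = cs ! Suc i"
    using assms unfolding curve_def by (metis Suc_lessD mod_less)
  have "cross \<sigma> (cs ! i) \<in> C" using assms curve_in_C by simp
  then show "v (cs ! Suc i) = cross \<sigma> (cs ! i)" using v(3) * by metis
qed

text \<open>Otherwise the two ends, moved towards each other, would meet in a fixed point of \<open>v\<close> or of
  \<open>cross \<sigma>\<close>.\<close>

lemma curve_oriented_le:
  assumes "curve \<sigma> cs" "i + d < length cs"
  shows "cross \<sigma> (cs ! i) \<noteq> cs ! (i + d)"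
  using assms(2)
proof (induction d arbitrary: i rule: less_induct)
  case (less d)
  have C: "cs ! i \<in> C" using less.prems assms(1) curve_in_C by simp
  show ?case
  proof (cases "d \<le> 1")
    case True
    then consider "d = 0" | "d = 1" by linarith
    then show ?thesis
    proof cases
      case 2
      then show ?thesis using curve_step(1)[OF assms(1), of i] less.prems C v(2) cross(1)
        by (metis add.commute plus_1_eq_Suc)
    qed (use C in auto)
  next
    case False
    \<comment> \<open>Both ends move inward by one position, so the distance drops by two.\<close>
    then obtain q where q: "d = Suc (Suc q)" by (metis One_nat_def Suc_le_mono le0 not0_implies_Suc)
    show ?thesis
    proof
      assume eq: "cross \<sigma> (cs ! i) = cs ! (i + d)"
      have "cs ! Suc i = v (cs ! Suc (i + Suc q))"
        using curve_step(1)[OF assms(1), of i] less.prems eq q by simp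
      also have "\<dots> = cross \<sigma> (cs ! (i + Suc q))"
        using curve_step(2)[OF assms(1), of "i + Suc q"] less.prems q by simp
      finally have "cross \<sigma> (cs ! Suc i) = cs ! (Suc i + q)"
        using curve_in_C[OF assms(1), of "i + Suc q"] less.prems q by simp
      then show False using less.IH[of q "Suc i"] less.prems q by simp
    qed
  qed
qed

text \<open>Entries and exits of a curve are thus disjoint sets of corners: no arc is run through in
  both directions.\<close>

lemma curve_oriented:
  assumes "curve \<sigma> cs" "i < length cs" "j < length cs"
  shows "cross \<sigma> (cs ! i) \<noteq> cs ! j"
proof (cases "i \<le> j")
  case True
  then show ?thesis using curve_oriented_le[OF assms(1), of i "j - i"] assms(3) by simp
next
  case False
  then have "cross \<sigma> (cs ! j) \<noteq> cs ! i"
    using curve_oriented_le[OF assms(1), of j "i - j"] assms(2) by simp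
  then show ?thesis using curve_in_C[OF assms(1,2)] by (metis cross(3))
qed

text \<open>The map from one entry to the next is a permutation of the finite set \<open>C\<close>;
  the curve is the orbit of \<open>c\<close>, listed over its least period \<open>L\<close>.\<close>

lemma curve_exists:
  assumes c: "c \<in> C"
  obtains cs where "curve \<sigma> cs" "cs ! 0 = c"
proof -
  define f where "f x = v (cross \<sigma> x)" for x
  have fC: "x \<in> C \<Longrightarrow> f x \<in> C" for x unfolding f_def by simp
  have inj: "inj_on f C"
    by (rule inj_on_inverseI[where g = "\<lambda>x. cross \<sigma> (v x)"]) (simp add: f_def)
  have fn: "(f ^^ n) c \<in> C" for n by (induction n) (use c fC in auto)
  obtain m where m: "m > 0" "(f ^^ m) c = c"
    using funpow_returns[OF finite_C inj _ c] fC by blast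
  define L where "L = (LEAST n. n > 0 \<and> (f ^^ n) c = c)"
  have L: "L > 0" "(f ^^ L) c = c"
    using LeastI[of "\<lambda>n. n > 0 \<and> (f ^^ n) c = c" m] m unfolding L_def by auto
  have least: "\<not> (n > 0 \<and> (f ^^ n) c = c)" if "n < L" for n
    using not_less_Least that unfolding L_def by blast
  \<comment> \<open>A repetition within the orbit cancels, by injectivity, to a return to
    \<open>c\<close> itself, which cannot happen before \<open>L\<close>.\<close>
  have cancel: "(f ^^ (j - i)) c = c" if "i \<le> j" "(f ^^ i) c = (f ^^ j) c" for i j
    using that
  proof (induction i arbitrary: j)
    case (Suc i)
    then obtain k where k: "j = Suc k" using Suc_le_D by blast
    have "(f ^^ i) c = (f ^^ k) c"
      using Suc.prems(2) inj fn unfolding k by (simp add: inj_on_eq_iff)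
    then show ?case using Suc.IH[of k] Suc.prems(1) k by simp
  qed simp
  have "inj_on (\<lambda>i. (f ^^ i) c) {0..<L}"
  proof (rule linorder_inj_onI)
    fix i j assume "i < j" "i \<in> {0..<L}" "j \<in> {0..<L}"
    then show "(f ^^ i) c \<noteq> (f ^^ j) c" using cancel[of i j] least[of "j - i"] by auto
  qed auto
  then have "curve \<sigma> (map (\<lambda>i. (f ^^ i) c) [0..<L])"
    unfolding curve_def using L fn
  proof (intro conjI allI impI)
    fix i assume "i < length (map (\<lambda>i. (f ^^ i) c) [0..<L])"
    then have i: "i < L" by simp
    have "(f ^^ Suc i) c = (f ^^ (Suc i mod L)) c"
      using i L by (cases "Suc i = L") auto
    then show "v (cross \<sigma> (map (\<lambda>i. (f ^^ i) c) [0..<L] ! i)) =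
      map (\<lambda>i. (f ^^ i) c) [0..<L] ! (Suc i mod length (map (\<lambda>i. (f ^^ i) c) [0..<L]))"
      using i L(1) by (simp add: f_def)
  qed (auto simp: distinct_map)
  moreover have "map (\<lambda>i. (f ^^ i) c) [0..<L] ! 0 = c" using L(1) by simp
  ultimately show thesis using that by blast
qed

text \<open>Entries and exits together are closed under the vertex arcs and under the chosen
  matchings, so they exhaust a class.\<close>

lemma curve_class:
  assumes cs: "curve \<sigma> cs" and c: "c \<in> set cs" and cd: "(c, d) \<in> glued (decided \<sigma>)"
  shows "d \<in> set cs \<or> cross \<sigma> d \<in> set cs"
  using cd
proof (induction rule: glued_induct)
  case (v d)
  let ?L = "length cs"
  have L: "?L > 0" using cs unfolding curve_def by simp
  from v(3) show ?case
  proof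
    assume "d \<in> set cs"
    then obtain i where i: "i < ?L" "d = cs ! i" by (auto simp: in_set_conv_nth)
    \<comment> \<open>The cyclic predecessor of \<open>i\<close>: at an entry, the vertex arc leads
      back to the previous exit.\<close>
    define j where "j = (if i = 0 then ?L - 1 else i - 1)"
    have "Suc j mod ?L = i" "j < ?L" using i(1) unfolding j_def by auto
    then have "v (cross \<sigma> (cs ! j)) = d" "cs ! j \<in> C"
      using cs i curve_in_C unfolding curve_def by auto
    then have "v d = cross \<sigma> (cs ! j)" using v by auto
    then show ?thesis using \<open>cs ! j \<in> C\<close> \<open>j < ?L\<close> by simp
  next
    assume "cross \<sigma> d \<in> set cs"
    then obtain i where i: "i < ?L" "cross \<sigma> d = cs ! i" by (auto simp: in_set_conv_nth)
    then have "v d = cs ! (Suc i mod ?L)"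
      using cs v(2) unfolding curve_def by (metis cross(3))
    then show ?thesis using L by simp
  qed
next
  case (mt d a)
  then have "mt a d = cross \<sigma> d" unfolding decided_def cross_def by simp
  then show ?case using mt by auto
qed (rule disjI1, rule c)

section \<open>Strands between two visits of an edge\<close>

text \<open>The strand runs from the exit at \<open>i\<close> to the entry at \<open>j\<close>, so
  \<open>N\<close> has to permit the current states only at the positions strictly between. The edge
  at both ends may be left out of \<open>N\<close>.\<close>

lemma curve_strand:
  assumes cs: "curve \<sigma> cs" and "i < j" "j < length cs"
    and N: "\<And>l. i < l \<Longrightarrow> l < j \<Longrightarrow> \<sigma> (ed (cs ! l)) \<in> N (ed (cs ! l))"
  shows "(cross \<sigma> (cs ! i), cs ! j) \<in> glued N"
  using assms(2-4)
proof (induction j)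
  case (Suc j)
  have j: "cs ! j \<in> C" using Suc.prems cs curve_in_C by simp
  then have step: "(cross \<sigma> (cs ! j), cs ! Suc j) \<in> glued N"
    using glued_v[of "cross \<sigma> (cs ! j)" N] curve_step(1)[OF cs Suc.prems(2)] by simp
  show ?case
  proof (cases "i = j")
    case False
    then have "(cross \<sigma> (cs ! i), cs ! j) \<in> glued N" using Suc by simp
    moreover have "(cs ! j, cross \<sigma> (cs ! j)) \<in> glued N"
      using glued_mt[OF j, of _ N] Suc.prems(1) Suc.prems(3)[of j] False unfolding cross_def by simp
    ultimately show ?thesis using step glued_trans by blast
  qed (use step in simp)
qed simp

text \<open>Two distinct entries and their exits already fill the four corners of \<open>e\<close>;
  a third entry would have to be one of the exits.\<close>

lemma curve_visits:
  assumes cs: "curve \<sigma> cs" and "i < j" "j < length cs" "ed (cs ! i) = e" "ed (cs ! j) = e"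
    and l: "l < length cs" "ed (cs ! l) = e"
  shows "l = i \<or> l = j"
proof (rule ccontr)
  assume ne: "\<not> (l = i \<or> l = j)"
  have C: "cs ! i \<in> C" "cs ! j \<in> C" "cs ! l \<in> C" using assms curve_in_C by auto
  have dist: "cs ! i \<noteq> cs ! j" "cs ! i \<noteq> cs ! l" "cs ! j \<noteq> cs ! l"
    using ne assms unfolding curve_def by (auto simp: nth_eq_iff_index_eq)
  obtain p where p: "cs ! j = mt p (cs ! i)" using same_edge[OF C(1,2)] assms dist by auto
  obtain q where q: "cs ! l = mt q (cs ! i)" using same_edge[OF C(1,3)] assms dist by auto
  have "p \<noteq> \<sigma> e" "q \<noteq> \<sigma> e"
    using curve_oriented[OF cs, of i j] curve_oriented[OF cs, of i l] assms p q
    unfolding cross_def by auto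
  moreover have "p \<noteq> q" using dist p q by auto
  ultimately have "cs ! l = cross \<sigma> (cs ! j)"
    using mt_mt[OF C(1), of "\<sigma> e" p q] assms p q unfolding cross_def by simp
  then show False using curve_oriented[OF cs _ l(1), of j] assms(3) by simp
qed

text \<open>The strand between the two visits avoids \<open>e\<close>, so its end points lie in one
  class of the cut gluing and must be matched by the type of the cut.\<close>

lemma curve_cut_type:
  assumes cs: "curve \<sigma> cs" and ij: "i < j" "j < length cs" "ed (cs ! i) = e" "ed (cs ! j) = e"
    and N: "\<And>f. f \<noteq> e \<Longrightarrow> \<sigma> f \<in> N f" and a: "cut_type N e a"
  shows "cs ! j = mt a (cross \<sigma> (cs ! i))"
proof -
  have C: "cs ! i \<in> C" "cs ! j \<in> C" using cs ij curve_in_C by auto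
  have "(cross \<sigma> (cs ! i), cs ! j) \<in> glued N"
  proof (rule curve_strand[OF cs ij(1,2)])
    fix l assume "i < l" "l < j"
    then have "ed (cs ! l) \<noteq> e" using curve_visits[OF cs ij, of l] ij by auto
    then show "\<sigma> (ed (cs ! l)) \<in> N (ed (cs ! l))" by (rule N)
  qed
  moreover have "cs ! j \<noteq> cross \<sigma> (cs ! i)" using curve_oriented[OF cs, of i j] ij by auto
  then obtain b where b: "cs ! j = mt b (cross \<sigma> (cs ! i))"
    using same_edge[of "cross \<sigma> (cs ! i)" "cs ! j"] C ij by auto
  ultimately show ?thesis using a C ij unfolding cut_type_def by (metis cross(1,4))
qed

text \<open>The visits of \<open>f\<close> lie on both strands between the visits of
  \<open>e\<close>. If \<open>f\<close> is undecided it glues the strands together, and the entry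
  \<open>cs ! k\<close> is connected to its own exit.\<close>

lemma interlaced_imp_not_cut_type:
  assumes cs: "curve \<sigma> cs" and ord: "i < j" "j < k" "k < l" "l < length cs"
    and e: "ed (cs ! i) = e" "ed (cs ! k) = e" and f: "ed (cs ! j) = f" "ed (cs ! l) = f"
    and N: "\<And>g. g \<noteq> e \<Longrightarrow> \<sigma> g \<in> N g" and Nf: "N f = UNIV"
  shows "\<not> cut_type N e a"
proof
  assume a: "cut_type N e a"
  have ik: "i < k" "k < length cs" using ord by auto
  note type = curve_cut_type[OF cs ik e N a]
  have C: "cs ! i \<in> C" "cs ! j \<in> C" "cs ! k \<in> C" "cs ! l \<in> C" using cs ord curve_in_C by auto
  have N': "\<sigma> (ed (cs ! m)) \<in> N (ed (cs ! m))" if "m \<noteq> i" "m \<noteq> k" "m < length cs" for m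
    using N curve_visits[OF cs ik e] that by blast
  have "(cs ! j, cs ! l) \<in> glued N"
    using same_edge[OF C(2,4)] glued_mt[OF C(2)] f Nf by auto
  moreover have "(cs ! j, cs ! k) \<in> glued N"
  proof -
    have "(cs ! j, cross \<sigma> (cs ! j)) \<in> glued N"
      unfolding cross_def using C(2) f Nf by (intro glued_mt) auto
    moreover have "(cross \<sigma> (cs ! j), cs ! k) \<in> glued N"
      by (rule curve_strand[OF cs]) (use ord N' in auto)
    ultimately show ?thesis by (rule glued_trans)
  qed
  moreover have "(cross \<sigma> (cs ! k), cs ! l) \<in> glued N"
    by (rule curve_strand[OF cs]) (use ord N' in auto)
  ultimately have "(cs ! k, cross \<sigma> (cs ! k)) \<in> glued N"
    by (meson glued_sym glued_trans)
  \<comment> \<open>The cut type would then be the current state, which would make the second entry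
    return to the first.\<close>
  then have "a = \<sigma> e" using a C e unfolding cut_type_def cross_def by auto
  then have "cs ! k = cs ! i" using type C e unfolding cross_def by (simp add: ed_mt)
  then show False using cs ord unfolding curve_def by (simp add: nth_eq_iff_index_eq)
qed

text \<open>The assumption \<open>single\<close> expresses minimality: the state glues as much as
  all matchings together. Then all four corners of an edge lie in one class, and that class is a
  single curve.\<close>

lemma curve_meets:
  assumes single: "\<And>x y. x \<in> C \<Longrightarrow> (x, y) \<in> glued (\<lambda>_. UNIV) \<Longrightarrow> (x, y) \<in> glued (decided \<sigma>)"
    and cs: "curve \<sigma> cs" and m: "m < length cs" and y: "y \<in> C" "ed y = ed (cs ! m)"
  shows "\<exists>l<length cs. cs ! l = y \<or> cs ! l = cross \<sigma> y"
proof -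
  have C: "cs ! m \<in> C" using curve_in_C[OF cs m] .
  have "(cs ! m, y) \<in> glued (\<lambda>_. UNIV)"
    using same_edge[OF C y] glued_mt[OF C] by auto
  then have "y \<in> set cs \<or> cross \<sigma> y \<in> set cs"
    using curve_class[OF cs] single[OF C] m nth_mem by blast
  then show ?thesis by (auto simp: in_set_conv_nth)
qed

lemma curve_second_visit:
  assumes single: "\<And>x y. x \<in> C \<Longrightarrow> (x, y) \<in> glued (\<lambda>_. UNIV) \<Longrightarrow> (x, y) \<in> glued (decided \<sigma>)"
    and c: "c \<in> C" "ed c = e" and cs: "curve \<sigma> cs" "cs ! 0 = c"
  obtains k where "0 < k" "k < length cs" "ed (cs ! k) = e"
proof -
  have L: "0 < length cs" using cs(1) unfolding curve_def by simp
  \<comment> \<open>For a matching other than the current state, neither \<open>mt b c\<close> nor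
    the corner matched to it by the state is \<open>c\<close>; the curve enters at one of them,
    which is the second visit.\<close>
  obtain b where b: "b \<noteq> \<sigma> e" by (metis state.distinct)
  obtain m where m: "m < length cs" "cs ! m = mt b c \<or> cs ! m = cross \<sigma> (mt b c)"
    using curve_meets[OF single cs(1) L, of "mt b c"] c cs ed_mt by auto
  have "cross \<sigma> (mt b c) \<noteq> c"
    using b c unfolding cross_def by (metis ed_mt mt(1,3) mt_inject)
  then have "m \<noteq> 0" using m c cs(2) mt(2) by metis
  moreover have "ed (cs ! m) = e" using m(2) c by (auto simp: ed_mt)
  ultimately show thesis using that m(1) by blast
qed

text \<open>If no edge of \<open>R\<close> is interlaced with \<open>e\<close>, the corners of the strand between the two visits
  of \<open>e\<close> stay separate even when all edges of \<open>R\<close> are left undecided.\<close>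

lemma not_connected_imp_interlaced:
  assumes single: "\<And>x y. x \<in> C \<Longrightarrow> (x, y) \<in> glued (\<lambda>_. UNIV) \<Longrightarrow> (x, y) \<in> glued (decided \<sigma>)"
    and c: "c \<in> C" "ed c = e"
    and conn: "\<And>x y. x \<in> C \<Longrightarrow> y \<in> C \<Longrightarrow> ed x = e \<Longrightarrow> ed y = e \<Longrightarrow> (x, y) \<in> glued N"
    and N: "N e = {}" "\<And>f. f \<notin> R \<Longrightarrow> N f \<subseteq> {\<sigma> f}"
  obtains cs i j k l f where "f \<in> R" "curve \<sigma> cs" "i < j" "j < k" "k < l" "l < length cs"
    "ed (cs ! i) = e" "ed (cs ! j) = f" "ed (cs ! k) = e" "ed (cs ! l) = f"
proof (rule ccontr)
  note found = that
  assume no: "\<not> thesis"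
  obtain cs where cs: "curve \<sigma> cs" "cs ! 0 = c" using curve_exists c(1) by blast
  let ?L = "length cs"
  have L: "0 < ?L" using cs unfolding curve_def by simp
  obtain k where k: "0 < k" "k < ?L" "ed (cs ! k) = e"
    using curve_second_visit[OF single c cs] .
  \<comment> \<open>The entries and exits on the strand that leaves \<open>e\<close> at position
    \<open>0\<close> and returns at position \<open>k\<close>.\<close>
  define P where "P = {x. (\<exists>i<k. x = cross \<sigma> (cs ! i)) \<or> (\<exists>i. 0 < i \<and> i \<le> k \<and> x = cs ! i)}"
  have "y \<in> P" if "(cross \<sigma> c, y) \<in> glued N" for y
    using that
  proof (induction rule: glued_induct)
    case refl
    then show ?case unfolding P_def using k cs by blast
  next
    case (v y)
    from v(3) consider i where "i < k" "y = cross \<sigma> (cs ! i)" | i where "0 < i" "i \<le> k" "y = cs ! i"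
      unfolding P_def by blast
    then show ?case
    proof cases
      case 1
      then have "v y = cs ! Suc i" using curve_step(1)[OF cs(1)] k by simp
      moreover have "0 < Suc i" "Suc i \<le> k" using 1 by auto
      ultimately show ?thesis unfolding P_def by blast
    next
      case 2
      then have "v y = cross \<sigma> (cs ! (i - 1))" using curve_step(2)[OF cs(1), of "i - 1"] k by simp
      moreover have "i - 1 < k" using 2 by auto
      ultimately show ?thesis unfolding P_def by blast
    qed
  next
    case (mt y a)
    then have ye: "ed y \<noteq> e" using N by auto
    obtain i where i: "0 < i" "i < k" "y = cs ! i \<or> y = cross \<sigma> (cs ! i)"
    proof -
      from mt(4) consider i where "i < k" "y = cross \<sigma> (cs ! i)" | i where "0 < i" "i \<le> k" "y = cs ! i"
        unfolding P_def by blast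
      then show thesis
      proof cases
        case 1
        then have "i \<noteq> 0" using ye c cs(2) by (metis cross(4))
        then show ?thesis using 1 that by blast
      next
        case 2
        then have "i \<noteq> k" using ye k by auto
        then show ?thesis using 2 that[of i] by simp
      qed
    qed
    have ci: "cs ! i \<in> C" using cs i k curve_in_C by simp
    have ei: "ed (cs ! i) = ed y" using i ci by auto
    have P: "z \<in> P" if "z = cs ! m \<or> z = cross \<sigma> (cs ! m)" "0 < m" "m < k" for z m
      using that unfolding P_def by auto
    show ?case
    proof (cases "ed y \<in> R")
      case False
      then have "mt a y = cross \<sigma> y" using mt(3) N(2) unfolding cross_def by auto
      then show ?thesis using P[of _ i] i ci by auto
    next
      case True
      obtain m where m: "m < ?L" "cs ! m = mt a y \<or> cs ! m = cross \<sigma> (mt a y)"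
        using curve_meets[OF single cs(1), of i "mt a y"] i k ei mt(2) by (auto simp: ed_mt)
      then have em: "ed (cs ! m) = ed y" using mt(2) by (auto simp: ed_mt)
      then have "m \<noteq> 0" "m \<noteq> k" using ye c(2) cs(2) k(3) by metis+
      \<comment> \<open>A visit \<open>m\<close> beyond \<open>k\<close> would give the pattern
        \<open>0 < i < k < m\<close> with \<open>e\<close> at \<open>0\<close> and \<open>k\<close>:
        an interlaced edge in \<open>R\<close>.\<close>
      moreover have "\<not> k < m"
        using no found[OF True cs(1) i(1,2) _ m(1)] ei em k c cs(2) by auto
      ultimately have "0 < m" "m < k" by auto
      moreover have "mt a y = cs ! m \<or> mt a y = cross \<sigma> (cs ! m)"
        using m(2) mt(2) by auto
      ultimately show ?thesis using P by blast
    qed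
  qed
  \<comment> \<open>Connectedness would put the entry \<open>c\<close> at position \<open>0\<close>
    on the strand, although it is neither an exit nor a later entry.\<close>
  then have "c \<in> P" using conn[of "cross \<sigma> c" c] c by simp
  then show False
  proof -
    assume "c \<in> P"
    then consider i where "i < k" "cs ! 0 = cross \<sigma> (cs ! i)" | i where "0 < i" "i \<le> k" "cs ! 0 = cs ! i"
      unfolding P_def using cs(2) by auto
    then show False
    proof cases
      case 1
      then show False using curve_oriented[OF cs(1) _ L, of i] k by simp
    next
      case 2
      then show False using cs(1) k L unfolding curve_def by (simp add: nth_eq_iff_index_eq)
    qed
  qed
qed

end

section \<open>Ribbon graphs as transition systems\<close>

locale ribbon =
  fixes G :: "('v, 'e, 'c) ribbon_graph"
  assumes ribbon_graph: "ribbon_graph G"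
begin

lemma rg [simp]:
  "finite (verts G)" "finite (edges G)" "finite (corners G)"
  "c \<in> corners G \<Longrightarrow> segm G c \<in> corners G" "c \<in> corners G \<Longrightarrow> eside G c \<in> corners G"
  "c \<in> corners G \<Longrightarrow> varc G c \<in> corners G"
  "c \<in> corners G \<Longrightarrow> segm G (segm G c) = c" "c \<in> corners G \<Longrightarrow> eside G (eside G c) = c"
  "c \<in> corners G \<Longrightarrow> varc G (varc G c) = c"
  "c \<in> corners G \<Longrightarrow> vert_of G c \<in> verts G" "c \<in> corners G \<Longrightarrow> edge_of G c \<in> edges G"
  "c \<in> corners G \<Longrightarrow> vert_of G (segm G c) = vert_of G c"
  "c \<in> corners G \<Longrightarrow> vert_of G (varc G c) = vert_of G c"
  "c \<in> corners G \<Longrightarrow> edge_of G (segm G c) = edge_of G c"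
  "c \<in> corners G \<Longrightarrow> edge_of G (eside G c) = edge_of G c"
  using ribbon_graph unfolding ribbon_graph_def pairing_on_def by auto

lemma segm_eside [simp]: "c \<in> corners G \<Longrightarrow> eside G (segm G c) = segm G (eside G c)"
  using segm_eside_commute(1)[OF ribbon_graph] by simp

lemma corners_distinct [simp]:
  assumes "c \<in> corners G"
  shows "segm G c \<noteq> c" "eside G c \<noteq> c" "segm G (eside G c) \<noteq> c" "segm G c \<noteq> eside G c"
  using segm_eside_commute(3)[OF ribbon_graph assms] by auto

lemma edge_has_corner: "e \<in> edges G \<Longrightarrow> \<exists>c\<in>corners G. edge_of G c = e"
proof -
  assume "e \<in> edges G"
  then have "card {c \<in> corners G. edge_of G c = e} = 4"
    using ribbon_graph unfolding ribbon_graph_def by blast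
  then have "{c \<in> corners G. edge_of G c = e} \<noteq> {}" by (metis card.empty zero_neq_numeral)
  then show ?thesis by blast
qed

lemma same_vertex_joined:
  "c \<in> corners G \<Longrightarrow> d \<in> corners G \<Longrightarrow> vert_of G c = vert_of G d \<Longrightarrow>
    (c, d) \<in> joined (corners G) (segm G) (varc G)"
  using ribbon_graph unfolding ribbon_graph_def by blast

text \<open>Boundary curves follow the two sides of a kept edge and, along the vertex circles, the
  two segments of a deleted one. A half-twist crosses the sides, which gives the two
  diagonals.\<close>

definition corner_match :: "state \<Rightarrow> 'c \<Rightarrow> 'c" where
  "corner_match a c =
     (case a of Keep \<Rightarrow> eside G c | Delete \<Rightarrow> segm G c | Twist \<Rightarrow> segm G (eside G c))"

lemma corner_match_simps [simp]:
  "corner_match Keep c = eside G c" "corner_match Delete c = segm G c"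
  "corner_match Twist c = segm G (eside G c)"
  unfolding corner_match_def by auto

sublocale transition_system "corners G" "edge_of G" "varc G" corner_match
proof
  show "pairing_on (corners G) (varc G)"
    using ribbon_graph unfolding ribbon_graph_def by blast
  show "pairing_on (corners G) (corner_match a)" for a
    unfolding pairing_on_def by (cases a) auto
  show "edge_of G (corner_match a c) = edge_of G c" if "c \<in> corners G" for a c
    using that by (cases a) auto
  show "corner_match a (corner_match b c) = corner_match k c"
    if "c \<in> corners G" "a \<noteq> b" "a \<noteq> k" "b \<noteq> k" for a b k c
    using that by (cases a; cases b; cases k) auto
  show "d = c \<or> (\<exists>a. d = corner_match a c)"
    if c: "c \<in> corners G" and d: "d \<in> corners G" "edge_of G d = edge_of G c" for c d
  proof -
    have "d \<in> {c, segm G c, eside G c, segm G (eside G c)}"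
      using segm_eside_commute(2)[OF ribbon_graph c] d by blast
    then show ?thesis
      by (metis corner_match_simps insertE singletonD)
  qed
qed simp

abbreviation isolated :: "'v set" where
  "isolated \<equiv> {v \<in> verts G. \<forall>c\<in>corners G. vert_of G c \<noteq> v}"

lemma joined_glued_UNIV:
  "(c, d) \<in> joined (corners G) (segm G) (varc G) \<Longrightarrow> (c, d) \<in> glued (\<lambda>_. UNIV)"
  unfolding joined_def
proof (induction rule: rtrancl_induct)
  case (step y z)
  then have "(y, z) \<in> glued (\<lambda>_. UNIV)"
    using glued_v glued_mt[of y Delete "\<lambda>_. UNIV"] by auto
  then show ?case using step glued_trans by blast
qed simp

section \<open>Components and boundary components as numbers of classes\<close>

text \<open>With all matchings allowed, segments and vertex arcs connect the corners of one vertex,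
  and sides lead to adjacent vertices. So classes of corners correspond to components with at least
  one edge.\<close>

lemma num_components_eq: "num_components G = num_glued (\<lambda>_. UNIV) + card isolated"
proof -
  define Q where "Q = {(vert_of G c, vert_of G (eside G c)) | c. c \<in> corners G}\<^sup>*"
  let ?R = "glued (\<lambda>_. UNIV)"
  have same: "(c, d) \<in> ?R" if "c \<in> corners G" "d \<in> corners G" "vert_of G c = vert_of G d" for c d
    using joined_glued_UNIV same_vertex_joined that by blast
  have cls: "Q `` {vert_of G c} = vert_of G ` (?R `` {c})" if c: "c \<in> corners G" for c
  proof (intro equalityI subsetI)
    fix w assume "w \<in> Q `` {vert_of G c}"
    then have "(vert_of G c, w) \<in> Q" by simp
    then show "w \<in> vert_of G ` (?R `` {c})" unfolding Q_def
    proof (induction rule: rtrancl_induct)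
      case (step y z)
      then obtain d e where d: "d \<in> corners G" "y = vert_of G d" "z = vert_of G (eside G d)"
        and e: "(c, e) \<in> ?R" "y = vert_of G e" by auto
      have "(e, d) \<in> ?R" using same[of e d] d e glued_in_C[OF e(1) c] by simp
      moreover have "(d, eside G d) \<in> ?R" using glued_mt[of d Keep "\<lambda>_. UNIV"] d by simp
      ultimately show ?case using d e by (blast intro: glued_trans)
    qed (auto intro: rev_image_eqI)
  next
    fix w assume "w \<in> vert_of G ` (?R `` {c})"
    then obtain d where d: "(c, d) \<in> ?R" "w = vert_of G d" by blast
    have "(vert_of G c, vert_of G d) \<in> Q"
      using d(1)
    proof (induction rule: glued_induct)
      case (mt d a)
      have "(vert_of G d, vert_of G (eside G d)) \<in> Q" unfolding Q_def using mt(2) by blast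
      then show ?case using mt(2,4) unfolding Q_def by (cases a) auto
    qed (auto simp: Q_def)
    then show "w \<in> Q `` {vert_of G c}" using d by simp
  qed
  have iso: "Q `` {w} = {w}" if "w \<in> isolated" for w
  proof -
    have "y = w" if "(w, y) \<in> Q" for y
      using that unfolding Q_def by (induction rule: rtrancl_induct) (use \<open>w \<in> isolated\<close> in auto)
    then show ?thesis unfolding Q_def by blast
  qed
  have vs: "verts G = vert_of G ` corners G \<union> isolated" by auto
  have quot: "verts G // Q = (\<lambda>K. vert_of G ` K) ` (corners G // ?R) \<union> (\<lambda>w. {w}) ` isolated"
    unfolding quotient_def by (subst vs) (use cls iso in auto)
  have inj: "inj_on (\<lambda>K. vert_of G ` K) (corners G // ?R)"
  proof (rule inj_onI)
    fix K L assume K: "K \<in> corners G // ?R" and L: "L \<in> corners G // ?R"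
      and eq: "vert_of G ` K = vert_of G ` L"
    obtain c where c: "c \<in> corners G" "K = ?R `` {c}" using K unfolding quotient_def by blast
    obtain d where d: "d \<in> corners G" "L = ?R `` {d}" using L unfolding quotient_def by blast
    have "vert_of G c \<in> vert_of G ` L" using eq c by auto
    then obtain d' where d': "(d, d') \<in> ?R" "vert_of G c = vert_of G d'" using d by blast
    then have "(c, d') \<in> ?R" using same c glued_in_C[OF d'(1) d(1)] by blast
    then have "(c, d) \<in> ?R" using d' glued_sym glued_trans by blast
    then show "K = L" using c d equiv_class_eq[OF equiv_glued] by blast
  qed
  have "finite (corners G // ?R)" by (simp add: quotient_def)
  moreover have "(\<lambda>K. vert_of G ` K) ` (corners G // ?R) \<inter> (\<lambda>w. {w}) ` isolated = {}"
    using cls glued_in_C unfolding quotient_def by fastforce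
  ultimately have "card (verts G // Q) = card (corners G // ?R) + card isolated"
    unfolding quot by (subst card_Un_disjoint) (auto simp: card_image[OF inj] card_image inj_on_def)
  then show ?thesis unfolding num_components_def num_glued_def Q_def .
qed

definition deleted :: "('e \<Rightarrow> state) \<Rightarrow> 'e set" where
  "deleted \<sigma> = {e \<in> edges G. \<sigma> e = Delete}"

definition twisted :: "('e \<Rightarrow> state) \<Rightarrow> 'e set" where
  "twisted \<sigma> = {e \<in> edges G. \<sigma> e = Twist}"

abbreviation petrial :: "('e \<Rightarrow> state) \<Rightarrow> ('v, 'e, 'c) ribbon_graph" where
  "petrial \<sigma> \<equiv> partial_petrial G (twisted \<sigma>)"

lemma petrial_simps [simp]:
  "corners (partial_petrial G Z) = corners G" "edge_of (partial_petrial G Z) = edge_of G"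
  "vert_of (partial_petrial G Z) = vert_of G" "verts (partial_petrial G Z) = verts G"
  "edges (partial_petrial G Z) = edges G" "segm (partial_petrial G Z) = segm G"
  "varc (partial_petrial G Z) = varc G"
  "eside (partial_petrial G Z) c = (if edge_of G c \<in> Z then segm G (eside G c) else eside G c)"
  unfolding partial_petrial_def by auto

lemma deleted_iff [simp]: "c \<in> corners G \<Longrightarrow> edge_of G c \<in> deleted \<sigma> \<longleftrightarrow> \<sigma> (edge_of G c) = Delete"
  unfolding deleted_def by simp

lemma twisted_iff [simp]: "c \<in> corners G \<Longrightarrow> edge_of G c \<in> twisted \<sigma> \<longleftrightarrow> \<sigma> (edge_of G c) = Twist"
  unfolding twisted_def by simp

lemma across_eq: "c \<in> corners G \<Longrightarrow> across (petrial \<sigma>) (deleted \<sigma>) c = cross \<sigma> c"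
  unfolding across_def cross_def by (cases "\<sigma> (edge_of G c)") simp_all

lemma tour_iff_curve: "tour (petrial \<sigma>) (deleted \<sigma>) cs \<longleftrightarrow> curve \<sigma> cs"
proof (cases "set cs \<subseteq> corners G")
  case True
  then have "cs ! i \<in> corners G" if "i < length cs" for i using that by auto
  then show ?thesis unfolding tour_def curve_def by (auto simp: across_eq)
qed (auto simp: tour_def curve_def)

text \<open>Gluing keeps the corners of deleted edges, whereas \<open>delete_edges\<close> drops
  them. Classes meeting the kept corners \<open>K\<close> correspond to boundary curves; classes
  missing \<open>K\<close> are whole circles of vertices that lose all their edges and are counted
  as isolated afterwards.\<close>

lemma num_boundary_eq:
  "num_boundary (delete_edges (petrial \<sigma>) (deleted \<sigma>)) = num_glued (decided \<sigma>) + card isolated"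
proof -
  let ?C = "corners G" and ?R = "glued (decided \<sigma>)" and ?H = "delete_edges (petrial \<sigma>) (deleted \<sigma>)"
  define K where "K = {c \<in> ?C. edge_of G c \<notin> deleted \<sigma>}"
  define walk where "walk c n = ((varc G \<circ> segm G) ^^ n) (varc G c)" for c n
  define va where "va c = walk c (LEAST n. edge_of G (walk c n) \<notin> deleted \<sigma>)" for c
  define J where "J = joined K (eside (petrial \<sigma>)) va"
  have H: "corners ?H = K" "eside ?H = eside (petrial \<sigma>)" "varc ?H = va"
    "verts ?H = verts G" "vert_of ?H = vert_of G"
    unfolding delete_edges_def K_def va_def walk_def by (auto simp: Let_def fun_eq_iff)
  have walk0: "walk c 0 = varc G c" and walk_Suc: "walk c (Suc n) = varc G (segm G (walk c n))" for c n
    unfolding walk_def by auto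
  have walk_C: "walk c n \<in> ?C" if "c \<in> ?C" for c n
    by (induction n) (use that in \<open>auto simp: walk0 walk_Suc\<close>)
  have K_C: "c \<in> ?C" if "c \<in> K" for c using that unfolding K_def by simp
  have eside_K: "eside (petrial \<sigma>) c = cross \<sigma> c" if "c \<in> K" for c
    using that across_eq[of c \<sigma>] unfolding K_def across_def by simp
  have returns: "\<exists>n. edge_of G (walk c n) \<notin> deleted \<sigma>" if c: "c \<in> K" for c
  proof -
    let ?f = "varc G \<circ> segm G"
    have inj: "inj_on ?f ?C"
      by (rule inj_on_inverseI[where g = "segm G \<circ> varc G"]) simp
    obtain n where n: "n > 0" "(?f ^^ n) (varc G c) = varc G c"
      by (rule funpow_returns[OF rg(3) inj, of "varc G c"]) (use K_C[OF c] in auto)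
    \<comment> \<open>One step before the walk closes up it stands at the other corner of the
      segment of \<open>c\<close>, whose edge is not deleted; so the least stopping time
      exists.\<close>
    then obtain m where m: "n = Suc m" using gr0_implies_Suc by blast
    have w: "walk c m \<in> ?C" using walk_C K_C c by blast
    have "varc G (segm G (walk c m)) = varc G c" using n(2) unfolding m walk_def by simp
    then have "segm G (walk c m) = c" using w K_C[OF c] by (metis rg(4,9))
    then have "edge_of G (walk c m) = edge_of G c" using w rg(14) by metis
    then show ?thesis using c unfolding K_def by (intro exI[of _ m]) auto
  qed
  have va_K: "va c \<in> K" if "c \<in> K" for c
    using LeastI_ex[OF returns[OF that]] walk_C[OF K_C[OF that]] unfolding va_def K_def by simp
  have va_eq: "va c = walk c n"
    if "edge_of G (walk c n) \<notin> deleted \<sigma>" "\<And>m. m < n \<Longrightarrow> edge_of G (walk c m) \<in> deleted \<sigma>" for c n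
  proof -
    have "(LEAST n. edge_of G (walk c n) \<notin> deleted \<sigma>) = n"
      by (rule Least_equality) (use that not_le in blast)+
    then show ?thesis unfolding va_def by simp
  qed
  have walk_R: "(c, walk c n) \<in> ?R"
    if "c \<in> ?C" "\<And>m. m < n \<Longrightarrow> edge_of G (walk c m) \<in> deleted \<sigma>" for c n
    using that(2)
  proof (induction n)
    case 0
    then show ?case using glued_v that(1) by (simp add: walk0)
  next
    case (Suc n)
    have w: "walk c n \<in> ?C" using walk_C that(1) .
    then have "(walk c n, segm G (walk c n)) \<in> ?R"
      using glued_mt[of "walk c n" Delete "decided \<sigma>"] Suc.prems[of n] by (simp add: decided_def)
    moreover have "(segm G (walk c n), walk c (Suc n)) \<in> ?R"
      unfolding walk_Suc using w by (intro glued_v) simp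
    ultimately show ?case using Suc glued_trans by (meson less_SucI)
  qed
  have J_R: "d \<in> K \<and> (c, d) \<in> ?R" if c: "c \<in> K" and "(c, d) \<in> J" for c d
    using that(2) unfolding J_def joined_def
  proof (induction rule: rtrancl_induct)
    case (step y z)
    then have y: "y \<in> K" "(c, y) \<in> ?R" by auto
    have "z \<in> K \<and> (y, z) \<in> ?R"
    proof (cases "z = eside (petrial \<sigma>) y")
      case True
      then have "z = cross \<sigma> y" using eside_K y by simp
      moreover have "(y, cross \<sigma> y) \<in> ?R"
        unfolding cross_def using K_C[OF y(1)] by (intro glued_mt) (auto simp: decided_def)
      ultimately show ?thesis using y unfolding K_def by simp
    next
      case False
      then have z: "z = va y" using step(2) by auto
      have "(y, va y) \<in> ?R"
        unfolding va_def by (rule walk_R) (use K_C y not_less_Least in blast)+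
      then show ?thesis using va_K y z by simp
    qed
    then show ?case using y glued_trans by blast
  qed (use c in simp)
  have J_step: "(c, cross \<sigma> d) \<in> J" "(c, va d) \<in> J" if "(c, d) \<in> J" "d \<in> K" for c d
  proof -
    let ?g = "{(c, eside (petrial \<sigma>) c) | c. c \<in> K} \<union> {(c, va c) | c. c \<in> K}"
    have "(d, cross \<sigma> d) \<in> ?g" "(d, va d) \<in> ?g"
      using that(2) eside_K[OF that(2), symmetric] by blast+
    then show "(c, cross \<sigma> d) \<in> J" "(c, va d) \<in> J"
      using that(1) unfolding J_def joined_def by (blast intro: rtrancl_into_rtrancl)+
  qed
  have R_J: "(c, d) \<in> J" if c: "c \<in> K" and cd: "(c, d) \<in> ?R" and d: "d \<in> K" for c d
  proof -
    \<comment> \<open>A dropped corner has no class in \<open>J\<close>. It is traced instead to a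
      reached corner \<open>y\<close> whose new vertex arc runs across it through deleted segments
      only.\<close>
    define P where "P x \<longleftrightarrow> (if x \<in> K then (c, x) \<in> J else
      \<exists>y n. y \<in> K \<and> (c, y) \<in> J \<and> (\<forall>m\<le>n. edge_of G (walk y m) \<in> deleted \<sigma>) \<and>
        (x = walk y n \<or> x = segm G (walk y n)))" for x
    have ext: "P (walk y n)"
      if y: "y \<in> K" "(c, y) \<in> J" and del: "\<forall>m<n. edge_of G (walk y m) \<in> deleted \<sigma>" for y n
    proof (cases "edge_of G (walk y n) \<in> deleted \<sigma>")
      case True
      then have "walk y n \<notin> K" unfolding K_def by simp
      moreover have "\<forall>m\<le>n. edge_of G (walk y m) \<in> deleted \<sigma>" using True del by (auto simp: le_less)
      ultimately show ?thesis using y unfolding P_def by auto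
    next
      case False
      then have "va y = walk y n" using va_eq del by blast
      moreover have "walk y n \<in> K" using False walk_C[OF K_C[OF y(1)]] unfolding K_def by simp
      ultimately show ?thesis using J_step(2) y unfolding P_def by metis
    qed
    have "P d"
      using cd
    proof (induction rule: glued_induct)
      case refl
      then show ?case using c unfolding P_def J_def joined_def by simp
    next
      case (v x)
      show ?case
      proof (cases "x \<in> K")
        case True
        then show ?thesis using ext[of x 0] v(3) walk0 unfolding P_def by auto
      next
        case False
        then obtain y n where y: "y \<in> K" "(c, y) \<in> J"
          "\<forall>m\<le>n. edge_of G (walk y m) \<in> deleted \<sigma>" "x = walk y n \<or> x = segm G (walk y n)"
          using v(3) unfolding P_def by auto
        note yC = K_C[OF y(1)]
        show ?thesis
        proof (cases "x = segm G (walk y n)")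
          case True
          then have "varc G x = walk y (Suc n)" by (simp add: walk_Suc)
          then show ?thesis using ext[of y "Suc n"] y by (auto simp: less_Suc_eq_le)
        next
          case False
          then have x: "x = walk y n" using y by blast
          show ?thesis
          proof (cases n)
            case 0
            \<comment> \<open>At the start of the walk, the old vertex arc leads back to
              \<open>y\<close> itself.\<close>
            then show ?thesis using x yC y unfolding P_def by (simp add: walk0)
          next
            case (Suc m)
            have w: "walk y m \<in> ?C" using walk_C yC .
            then have vx: "varc G x = segm G (walk y m)" using x Suc by (simp add: walk_Suc)
            have "edge_of G (walk y m) \<in> deleted \<sigma>" using y(3) Suc by simp
            then have "varc G x \<notin> K" unfolding vx K_def using w by simp
            moreover have "\<forall>q\<le>m. edge_of G (walk y q) \<in> deleted \<sigma>" using y(3) Suc by simp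
            ultimately show ?thesis unfolding P_def vx using y(1,2) by auto
          qed
        qed
      qed
    next
      case (mt x a)
      then have a: "corner_match a x = cross \<sigma> x" unfolding cross_def decided_def by simp
      show ?case
      proof (cases "x \<in> K")
        case True
        then have "cross \<sigma> x \<in> K" unfolding K_def by simp
        then show ?thesis using J_step(1)[of c x] mt(4) True a unfolding P_def by simp
      next
        case False
        then obtain y n where y: "y \<in> K" "(c, y) \<in> J"
          "\<forall>m\<le>n. edge_of G (walk y m) \<in> deleted \<sigma>" "x = walk y n \<or> x = segm G (walk y n)"
          using mt(4) unfolding P_def by auto
        have "cross \<sigma> x = segm G x" "cross \<sigma> x \<notin> K"
          using False mt(2) unfolding K_def cross_def by auto
        moreover have "segm G x = segm G (walk y n) \<or> segm G x = walk y n"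
          using y(4) walk_C[OF K_C[OF y(1)], of n] by auto
        ultimately show ?thesis using y a unfolding P_def by auto
      qed
    qed
    then show ?thesis using d unfolding P_def by simp
  qed
  have J_cls: "J `` {c} = ?R `` {c} \<inter> K" if "c \<in> K" for c
    using J_R[OF that] R_J[OF that] by blast
  let ?meet = "{B \<in> ?C // ?R. B \<inter> K \<noteq> {}}" and ?miss = "{B \<in> ?C // ?R. B \<inter> K = {}}"
  let ?lost = "{w \<in> verts G. (\<exists>c\<in>?C. vert_of G c = w) \<and> (\<forall>c\<in>K. vert_of G c \<noteq> w)}"
  have "bij_betw (\<lambda>B. B \<inter> K) ?meet (K // J)"
    unfolding bij_betw_def
  proof
    show "inj_on (\<lambda>B. B \<inter> K) ?meet"
    proof (rule inj_onI)
      fix A B assume AB: "A \<in> ?meet" "B \<in> ?meet" "A \<inter> K = B \<inter> K"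
      then obtain x where "x \<in> A" "x \<in> B" by blast
      moreover have "A \<in> UNIV // ?R" "B \<in> UNIV // ?R" using AB unfolding quotient_def by auto
      ultimately show "A = B" using quotient_disj[OF equiv_glued] by blast
    qed
    show "(\<lambda>B. B \<inter> K) ` ?meet = K // J"
    proof (intro equalityI subsetI)
      fix A assume "A \<in> (\<lambda>B. B \<inter> K) ` ?meet"
      then obtain c d where "A = ?R `` {c} \<inter> K" "d \<in> ?R `` {c} \<inter> K" unfolding quotient_def by blast
      then have "A = J `` {d}" "d \<in> K"
        using J_cls[of d] equiv_class_eq[OF equiv_glued, of c d] by auto
      then show "A \<in> K // J" by (simp add: quotientI)
    next
      fix A assume "A \<in> K // J"
      then obtain d where d: "d \<in> K" "A = ?R `` {d} \<inter> K" using J_cls unfolding quotient_def by blast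
      then have "d \<in> ?R `` {d} \<inter> K" by simp
      then have "?R `` {d} \<in> ?meet" using quotientI[OF K_C[OF d(1)], of ?R] by blast
      then show "A \<in> (\<lambda>B. B \<inter> K) ` ?meet" using d by blast
    qed
  qed
  then have meet: "card (K // J) = card ?meet" by (simp add: bij_betw_same_card)
  define at where "at w = {c \<in> ?C. vert_of G c = w}" for w
  \<comment> \<open>Under either hypothesis only deleted edges are met, where the chosen matching is
    \<open>segm\<close>; class and vertex circle are then generated by the same moves. The two
    alternatives serve the two inclusions between \<open>?lost\<close> and
    \<open>?miss\<close>.\<close>
  have miss_class: "?R `` {c} = at (vert_of G c)"
    if c: "c \<in> ?C" and del: "?R `` {c} \<inter> K = {} \<or> at (vert_of G c) \<inter> K = {}" for c
  proof -
    have R_at: "(c, x) \<in> ?R \<Longrightarrow> x \<in> at (vert_of G c)" for x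
    proof (induction rule: glued_induct)
      case (mt x a)
      then have "x \<notin> K" using del by auto
      then have "corner_match a x = segm G x" using mt(2,3) unfolding K_def decided_def by simp
      then show ?case using mt(2,4) unfolding at_def by simp
    qed (use c in \<open>auto simp: at_def\<close>)
    have "(c, x) \<in> ?R" if "x \<in> at (vert_of G c)" for x
    proof -
      have "(c, x) \<in> joined ?C (segm G) (varc G)"
        using same_vertex_joined c that unfolding at_def by simp
      then show ?thesis unfolding joined_def
      proof (induction rule: rtrancl_induct)
        case (step y z)
        then have yC: "y \<in> ?C" by auto
        have "y \<notin> K" using step(3) R_at del by auto
        then have "(y, segm G y) \<in> ?R"
          using glued_mt[OF yC, of Delete "decided \<sigma>"] yC unfolding K_def decided_def by simp
        then have "(y, z) \<in> ?R" using step(2) glued_v[OF yC] by auto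
        then show ?case using step(3) glued_trans by blast
      qed simp
    qed
    then show ?thesis using R_at by blast
  qed
  have "bij_betw at ?lost ?miss"
    unfolding bij_betw_def
  proof
    show "inj_on at ?lost" unfolding at_def by (rule inj_onI) blast
    show "at ` ?lost = ?miss"
    proof (intro equalityI subsetI)
      fix B assume "B \<in> at ` ?lost"
      then obtain c where c: "c \<in> ?C" "B = at (vert_of G c)" "\<forall>d\<in>K. vert_of G d \<noteq> vert_of G c" by auto
      then have "B \<inter> K = {}" unfolding at_def by auto
      moreover have "B = ?R `` {c}" using miss_class[OF c(1)] c(2) \<open>B \<inter> K = {}\<close> by simp
      then have "B \<in> ?C // ?R" using quotientI[OF c(1), of ?R] by simp
      ultimately show "B \<in> ?miss" by blast
    next
      fix B assume B: "B \<in> ?miss"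
      then obtain c where c: "c \<in> ?C" "B = ?R `` {c}" unfolding quotient_def by blast
      then have "B = at (vert_of G c)" using miss_class B by auto
      moreover have "vert_of G c \<in> ?lost"
      proof -
        have "vert_of G d \<noteq> vert_of G c" if "d \<in> K" for d
          using that B K_C unfolding \<open>B = at (vert_of G c)\<close> at_def by auto
        then show ?thesis using c by auto
      qed
      ultimately show "B \<in> at ` ?lost" by blast
    qed
  qed
  then have miss: "card ?lost = card ?miss" by (simp add: bij_betw_same_card)
  have fin: "finite (?C // ?R)" by (simp add: quotient_def)
  have "num_boundary ?H = card (K // J) + card {w \<in> verts G. \<forall>c\<in>K. vert_of G c \<noteq> w}"
    unfolding num_boundary_def H J_def ..
  also have "{w \<in> verts G. \<forall>c\<in>K. vert_of G c \<noteq> w} = ?lost \<union> isolated"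
    using K_C by blast
  also have "card (?lost \<union> isolated) = card ?lost + card isolated"
    by (rule card_Un_disjoint) auto
  also have "card (K // J) + (card ?lost + card isolated) = card (?C // ?R) + card isolated"
  proof -
    have "?C // ?R = ?meet \<union> ?miss" by auto
    moreover have "card (?meet \<union> ?miss) = card ?meet + card ?miss"
      using fin by (intro card_Un_disjoint) auto
    ultimately show ?thesis using meet miss by simp
  qed
  finally show ?thesis unfolding num_glued_def .
qed

section \<open>Activities and cuts\<close>

lemma edge_orientation_cases:
  assumes "edge_orientation (petrial \<sigma>) e D"
  obtains p where "p \<in> corners G" "edge_of G p = e"
    "D = (if \<sigma> e = Twist
      then {(p, segm G p), (segm G p, eside G p), (eside G p, segm G (eside G p)), (segm G (eside G p), p)}
      else {(p, segm G p), (segm G p, segm G (eside G p)), (segm G (eside G p), eside G p), (eside G p, p)})"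
  using assms unfolding edge_orientation_def by (auto simp: Let_def)

text \<open>The state at an active edge that splits the boundary curve, given orientability and the
  current state.\<close>

definition flip :: "bool \<Rightarrow> state \<Rightarrow> state" where
  "flip nonor a = (if nonor then (case a of Keep \<Rightarrow> Twist | Delete \<Rightarrow> Twist | Twist \<Rightarrow> Keep)
     else (case a of Keep \<Rightarrow> Delete | Delete \<Rightarrow> Keep | Twist \<Rightarrow> Delete))"

text \<open>The second passage enters at \<open>d\<close>, and of the two values \<open>a\<close>
  other than the current state one makes it run around the edge disc in the same sense as the first,
  the other in the opposite sense. \<open>flip\<close> tabulates this; the proof checks each
  position of \<open>c\<close>, each state and each \<open>a\<close>.\<close>

lemma orientation_agreement:
  assumes D: "edge_orientation (petrial \<sigma>) e D" and c: "c \<in> corners G" "edge_of G c = e"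
    and a: "a \<noteq> \<sigma> e" and d: "d = corner_match a (cross \<sigma> c)"
  shows "((c, cross \<sigma> c) \<in> D) \<noteq> ((d, cross \<sigma> d) \<in> D) \<longleftrightarrow> a = flip True (\<sigma> e)"
    and "\<not> (((c, cross \<sigma> c) \<in> D) \<noteq> ((d, cross \<sigma> d) \<in> D)) \<longleftrightarrow> a = flip False (\<sigma> e)"
proof -
  obtain p where p: "p \<in> corners G" "edge_of G p = e"
    and D': "D = (if \<sigma> e = Twist
      then {(p, segm G p), (segm G p, eside G p), (eside G p, segm G (eside G p)), (segm G (eside G p), p)}
      else {(p, segm G p), (segm G p, segm G (eside G p)), (segm G (eside G p), eside G p), (eside G p, p)})"
    using edge_orientation_cases[OF D] .
  note neq = corners_distinct[OF p(1)] corners_distinct[OF p(1), symmetric]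
    corners_distinct[of "segm G p"] corners_distinct[of "eside G p"]
    corners_distinct[of "segm G (eside G p)"]
  obtain b where "c = p \<or> c = corner_match b p" using same_edge[OF p(1) c(1)] c p by auto
  then consider "c = p" | "c = segm G p" | "c = eside G p" | "c = segm G (eside G p)"
    by (cases b) auto
  then have "(((c, cross \<sigma> c) \<in> D) \<noteq> ((d, cross \<sigma> d) \<in> D)) = (a = flip True (\<sigma> e)) \<and>
    (a = flip False (\<sigma> e)) = (a \<noteq> flip True (\<sigma> e))"
    by cases
      (cases "\<sigma> e"; cases a; use a p neq in \<open>simp add: D' d flip_def cross_def\<close>)+
  then show "((c, cross \<sigma> c) \<in> D) \<noteq> ((d, cross \<sigma> d) \<in> D) \<longleftrightarrow> a = flip True (\<sigma> e)"
    and "\<not> (((c, cross \<sigma> c) \<in> D) \<noteq> ((d, cross \<sigma> d) \<in> D)) \<longleftrightarrow> a = flip False (\<sigma> e)"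
    by auto
qed

definition states_of :: "('e \<Rightarrow> state) \<Rightarrow> 'e set \<times> 'e set \<times> 'e set" where
  "states_of \<sigma> = ({e \<in> edges G. \<sigma> e = Keep}, deleted \<sigma>, twisted \<sigma>)"

text \<open>Without a cut, the strand between two visits of \<open>e\<close> must be left through a
  smaller edge, which is then interlaced with \<open>e\<close>; with a cut, a smaller interlaced
  edge would be undecided and join the two strands.\<close>

lemma active_iff:
  assumes prec: "irrefl prec"
    and single: "\<And>x y. x \<in> corners G \<Longrightarrow> (x, y) \<in> glued (\<lambda>_. UNIV) \<Longrightarrow> (x, y) \<in> glued (decided \<sigma>)"
    and e: "e \<in> edges G" and N: "N = beneath (prec \<inter> edges G \<times> edges G) \<sigma> e"
  shows "active G prec (states_of \<sigma>) e \<longleftrightarrow> (\<exists>a. cut_type N e a)"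
proof
  obtain c where c: "c \<in> corners G" "edge_of G c = e" using edge_has_corner[OF e] by blast
  let ?R = "{f \<in> edges G. (f, e) \<in> prec}"
  have act: "active G prec (states_of \<sigma>) e \<longleftrightarrow>
    \<not> (\<exists>f\<in>?R. interlaced (petrial \<sigma>) (deleted \<sigma>) e f)"
    unfolding active_def states_of_def by auto
  {
    assume active: "active G prec (states_of \<sigma>) e"
    show "\<exists>a. cut_type N e a"
    proof (rule ccontr)
      assume "\<not> (\<exists>a. cut_type N e a)"
      then have conn: "\<forall>c\<in>corners G. \<forall>d\<in>corners G. edge_of G c = e \<longrightarrow> edge_of G d = e \<longrightarrow>
          (c, d) \<in> glued N"
        using cut_type_dichotomy[of N e] unfolding N beneath_def by auto
      obtain cs i j k l f where w: "f \<in> ?R" "curve \<sigma> cs" "i < j" "j < k" "k < l" "l < length cs"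
        "edge_of G (cs ! i) = e" "edge_of G (cs ! j) = f"
        "edge_of G (cs ! k) = e" "edge_of G (cs ! l) = f"
      proof (rule not_connected_imp_interlaced[OF single c, of N ?R])
        show "(x, y) \<in> glued N"
          if "x \<in> corners G" "y \<in> corners G" "edge_of G x = e" "edge_of G y = e" for x y
          using conn that by blast
      qed (use e in \<open>auto simp: N beneath_def\<close>)
      then have "interlaced (petrial \<sigma>) (deleted \<sigma>) e f"
        unfolding interlaced_def tour_iff_curve petrial_simps by blast
      then show False using active act w(1) by blast
    qed
  }
  {
    assume "\<exists>a. cut_type N e a"
    then obtain a where a: "cut_type N e a" by blast
    show "active G prec (states_of \<sigma>) e"
      unfolding act
    proof
      assume "\<exists>f\<in>?R. interlaced (petrial \<sigma>) (deleted \<sigma>) e f"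
      then obtain f cs i j k l where f: "f \<in> ?R" and w: "curve \<sigma> cs" "i < j" "j < k" "k < l"
        "l < length cs" "edge_of G (cs ! i) = e" "edge_of G (cs ! k) = e"
        "edge_of G (cs ! j) = f" "edge_of G (cs ! l) = f"
        unfolding interlaced_def tour_iff_curve petrial_simps by blast
      have "f \<noteq> e" using f prec unfolding irrefl_def by blast
      then have "N f = UNIV" using f e unfolding N beneath_def by simp
      then have "\<not> cut_type N e a"
        by (intro interlaced_imp_not_cut_type[OF w]) (auto simp: N beneath_def)
      then show False using a by blast
    qed
  }
qed

text \<open>The type of the cut fixes where every curve re-enters \<open>e\<close>, so the arbitrary
  choices in the definition of nonorientability cannot lead to different answers.\<close>

lemma nonorientable_iff:
  assumes single: "\<And>x y. x \<in> corners G \<Longrightarrow> (x, y) \<in> glued (\<lambda>_. UNIV) \<Longrightarrow> (x, y) \<in> glued (decided \<sigma>)"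
    and e: "e \<in> edges G" and N: "\<And>f. f \<noteq> e \<Longrightarrow> \<sigma> f \<in> N f" and a: "cut_type N e a"
  shows "a = flip (nonorientable G (states_of \<sigma>) e) (\<sigma> e)"
proof -
  have type: "a \<noteq> \<sigma> e \<and> cs ! i \<in> corners G \<and> cs ! j \<in> corners G \<and>
      cs ! j = corner_match a (cross \<sigma> (cs ! i))"
    if w: "curve \<sigma> cs" "i < j" "j < length cs" "edge_of G (cs ! i) = e" "edge_of G (cs ! j) = e"
    for cs i j
  proof -
    have C: "cs ! i \<in> corners G" "cs ! j \<in> corners G" using curve_in_C[OF w(1)] w by auto
    have t: "cs ! j = corner_match a (cross \<sigma> (cs ! i))" using curve_cut_type[OF w N a] .
    have "cs ! i \<noteq> cs ! j" using w unfolding curve_def by (auto simp: nth_eq_iff_index_eq)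
    then have "a \<noteq> \<sigma> e" using t w(4) C unfolding cross_def by auto
    then show ?thesis using C t by blast
  qed
  have nonor: "nonorientable G (states_of \<sigma>) e \<longleftrightarrow>
    (\<exists>cs i j D. curve \<sigma> cs \<and> edge_orientation (petrial \<sigma>) e D \<and> i < j \<and> j < length cs \<and>
      edge_of G (cs ! i) = e \<and> edge_of G (cs ! j) = e \<and>
      ((cs ! i, cross \<sigma> (cs ! i)) \<in> D) \<noteq> ((cs ! j, cross \<sigma> (cs ! j)) \<in> D))"
    unfolding nonorientable_def states_of_def nonorientable_edge_def prod.case petrial_simps tour_iff_curve
    by (intro ex_cong1 conj_cong refl) (simp add: across_eq curve_in_C)
  \<comment> \<open>Nonorientability is existential, so using its negation requires an actual curve
    with two visits and an actual orientation of \<open>e\<close>.\<close>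
  obtain c where c: "c \<in> corners G" "edge_of G c = e" using edge_has_corner[OF e] by blast
  obtain D where D: "edge_orientation (petrial \<sigma>) e D"
    using c unfolding edge_orientation_def by (auto simp: Let_def)
  obtain cs where cs: "curve \<sigma> cs" "cs ! 0 = c" using curve_exists[OF c(1)] .
  obtain k where k: "0 < k" "k < length cs" "edge_of G (cs ! k) = e"
    using curve_second_visit[OF single c cs] .
  have t: "a \<noteq> \<sigma> e" "cs ! k = corner_match a (cross \<sigma> c)"
    using type[of cs 0 k] cs k c by auto
  show ?thesis
  proof (cases "nonorientable G (states_of \<sigma>) e")
    case True
    then obtain cs i j D where w: "curve \<sigma> cs" "i < j" "j < length cs"
        "edge_of G (cs ! i) = e" "edge_of G (cs ! j) = e"
      and D: "edge_orientation (petrial \<sigma>) e D"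
      and ne: "((cs ! i, cross \<sigma> (cs ! i)) \<in> D) \<noteq> ((cs ! j, cross \<sigma> (cs ! j)) \<in> D)"
      unfolding nonor by blast
    from type[OF w] have ci: "cs ! i \<in> corners G" "a \<noteq> \<sigma> e" "cs ! j = corner_match a (cross \<sigma> (cs ! i))"
      by blast+
    have "a = flip True (\<sigma> e)"
      using orientation_agreement(1)[OF D ci(1) w(4) ci(2,3)] ne by (rule iffD1)
    then show ?thesis using True by simp
  next
    case False
    then have "\<not> (((c, cross \<sigma> c) \<in> D) \<noteq> ((cs ! k, cross \<sigma> (cs ! k)) \<in> D))"
      unfolding nonor using cs k c D by blast
    with orientation_agreement(2)[OF D c t] have "a = flip False (\<sigma> e)" by (rule iffD1)
    then show ?thesis using False by simp
  qed
qed

lemma activity_weight_eq: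
  fixes w :: "'e \<Rightarrow> state \<Rightarrow> 'r::comm_ring_1"
  assumes prec: "irrefl prec"
    and single: "\<And>x y. x \<in> corners G \<Longrightarrow> (x, y) \<in> glued (\<lambda>_. UNIV) \<Longrightarrow> (x, y) \<in> glued (decided \<sigma>)"
    and e: "e \<in> edges G"
  shows "activity_weight w u (prec \<inter> edges G \<times> edges G) \<sigma> e =
    (if active G prec (states_of \<sigma>) e
     then u * w e (flip (nonorientable G (states_of \<sigma>) e) (\<sigma> e)) + w e (\<sigma> e) else w e (\<sigma> e))"
proof -
  define N where "N = beneath (prec \<inter> edges G \<times> edges G) \<sigma> e"
  have act: "active G prec (states_of \<sigma>) e \<longleftrightarrow> (\<exists>a. cut_type N e a)"
    using active_iff[OF prec single e N_def] .
  have "a = flip (nonorientable G (states_of \<sigma>) e) (\<sigma> e)" if "cut_type N e a" for a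
    by (rule nonorientable_iff[OF single e _ that]) (auto simp: N_def beneath_def)
  then have "{a. cut_type N e a} =
    (if active G prec (states_of \<sigma>) e then {flip (nonorientable G (states_of \<sigma>) e) (\<sigma> e)} else {})"
    using act by auto
  then show ?thesis unfolding activity_weight_def N_def[symmetric] by (simp add: add.commute)
qed

section \<open>Translation of the state sum into the polynomial identity\<close>

definition indet_of :: "'e \<Rightarrow> state \<Rightarrow> 'e polynomial" where
  "indet_of e a = Var (case a of Keep \<Rightarrow> Alpha e | Delete \<Rightarrow> Beta e | Twist \<Rightarrow> Gamma e)"

lemma prod_states:
  "(\<Prod>e\<in>edges G. g e) =
    (\<Prod>e\<in>{e \<in> edges G. \<sigma> e = Keep}. g e) * (\<Prod>e\<in>deleted \<sigma>. g e) * (\<Prod>e\<in>twisted \<sigma>. g e)"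
proof -
  let ?X = "{e \<in> edges G. \<sigma> e = Keep}"
  have "prod g (edges G) = prod g (?X \<union> deleted \<sigma> \<union> twisted \<sigma>)"
    unfolding deleted_def twisted_def using state.exhaust by (intro prod.cong) auto
  also have "\<dots> = prod g (?X \<union> deleted \<sigma>) * prod g (twisted \<sigma>)"
    unfolding deleted_def twisted_def by (intro prod.union_disjoint) auto
  also have "prod g (?X \<union> deleted \<sigma>) = prod g ?X * prod g (deleted \<sigma>)"
    unfolding deleted_def by (intro prod.union_disjoint) auto
  finally show ?thesis .
qed

lemma prod_activities:
  assumes "finite S"
  shows "(\<Prod>e\<in>S. g e) =
    (\<Prod>e\<in>IA G prec P S. g e) * (\<Prod>e\<in>AO G prec P S. g e) * (\<Prod>e\<in>AN G prec P S. g e)"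
proof -
  have S: "S = IA G prec P S \<union> AO G prec P S \<union> AN G prec P S"
    unfolding IA_def AO_def AN_def by auto
  have fin: "finite (IA G prec P S)" "finite (AO G prec P S)" "finite (AN G prec P S)"
    using assms unfolding IA_def AO_def AN_def by auto
  have disj: "IA G prec P S \<inter> AO G prec P S = {}"
    "(IA G prec P S \<union> AO G prec P S) \<inter> AN G prec P S = {}"
    unfolding IA_def AO_def AN_def by auto
  have "prod g S = prod g (IA G prec P S \<union> AO G prec P S \<union> AN G prec P S)"
    using S by simp
  then show ?thesis using fin disj by (simp add: prod.union_disjoint)
qed

text \<open>Fixing the value \<open>Keep\<close> outside the edge set makes a state recoverable from
  its three blocks.\<close>

lemma bij_betw_states_of:
  "bij_betw states_of (agree (\<lambda>_. Keep) (edges G)) (ordered_partitions3 (edges G))"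
proof (rule bij_betw_byWitness)
  let ?g = "\<lambda>(X, Y, Z) e. if e \<in> Y then Delete else if e \<in> Z then Twist else Keep"
  show "states_of ` agree (\<lambda>_. Keep) (edges G) \<subseteq> ordered_partitions3 (edges G)"
  proof (intro image_subsetI)
    fix \<sigma> :: "'e \<Rightarrow> state"
    have "e \<in> edges G \<Longrightarrow> \<sigma> e = Keep \<or> \<sigma> e = Delete \<or> \<sigma> e = Twist" for e
      by (cases "\<sigma> e") auto
    then show "states_of \<sigma> \<in> ordered_partitions3 (edges G)"
      unfolding states_of_def ordered_partitions3_def deleted_def twisted_def by auto
  qed
  show "?g ` ordered_partitions3 (edges G) \<subseteq> agree (\<lambda>_. Keep) (edges G)"
    unfolding ordered_partitions3_def agree_def by auto
  show "\<forall>\<sigma>\<in>agree (\<lambda>_. Keep) (edges G). ?g (states_of \<sigma>) = \<sigma>"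
  proof (intro ballI ext)
    fix \<sigma> e assume "\<sigma> \<in> agree (\<lambda>_. Keep) (edges G)"
    then show "?g (states_of \<sigma>) e = \<sigma> e"
      unfolding states_of_def deleted_def twisted_def agree_def by (cases "\<sigma> e") auto
  qed
  show "\<forall>P\<in>ordered_partitions3 (edges G). states_of (?g P) = P"
    unfolding states_of_def deleted_def twisted_def ordered_partitions3_def by auto
qed

definition activity_term :: "'e rel \<Rightarrow> 'e set \<times> 'e set \<times> 'e set \<Rightarrow> 'e polynomial" where
  "activity_term prec = (\<lambda>(X, Y, Z).
      (\<Prod>e\<in>IA G prec (X, Y, Z) X. Var (Alpha e)) *
      (\<Prod>e\<in>IA G prec (X, Y, Z) Y. Var (Beta e)) *
      (\<Prod>e\<in>IA G prec (X, Y, Z) Z. Var (Gamma e)) *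
      (\<Prod>e\<in>AO G prec (X, Y, Z) X. half * Var T * Var (Beta e) + Var (Alpha e)) *
      (\<Prod>e\<in>AO G prec (X, Y, Z) Y. half * Var T * Var (Alpha e) + Var (Beta e)) *
      (\<Prod>e\<in>AO G prec (X, Y, Z) Z. half * Var T * Var (Beta e) + Var (Gamma e)) *
      (\<Prod>e\<in>AN G prec (X, Y, Z) X. half * Var T * Var (Gamma e) + Var (Alpha e)) *
      (\<Prod>e\<in>AN G prec (X, Y, Z) Y. half * Var T * Var (Gamma e) + Var (Beta e)) *
      (\<Prod>e\<in>AN G prec (X, Y, Z) Z. half * Var T * Var (Alpha e) + Var (Gamma e)))"

text \<open>On each block the current state is constant, so on its active orientable and active
  nonorientable parts \<open>flip\<close> is constant too and names the indeterminate that is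
  multiplied by half of \<open>t\<close>.\<close>

lemma activity_term_eq:
  assumes prec: "irrefl prec"
    and single: "\<And>x y. x \<in> corners G \<Longrightarrow> (x, y) \<in> glued (\<lambda>_. UNIV) \<Longrightarrow> (x, y) \<in> glued (decided \<sigma>)"
  shows "(\<Prod>e\<in>edges G. activity_weight indet_of (half * Var T) (prec \<inter> edges G \<times> edges G) \<sigma> e) =
    activity_term prec (states_of \<sigma>)"
proof -
  define A where "A e = activity_weight indet_of (half * Var T) (prec \<inter> edges G \<times> edges G) \<sigma> e" for e
  define X where "X = {e \<in> edges G. \<sigma> e = Keep}"
  define Y where "Y = deleted \<sigma>"
  define Z where "Z = twisted \<sigma>"
  define P where "P = (X, Y, Z)"
  have P: "states_of \<sigma> = P" unfolding P_def X_def Y_def Z_def states_of_def ..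
  have A: "A e = (if active G prec P e
      then half * Var T * indet_of e (flip (nonorientable G P e) (\<sigma> e)) + indet_of e (\<sigma> e)
      else indet_of e (\<sigma> e))" if "e \<in> edges G" for e
    unfolding A_def P[symmetric] by (rule activity_weight_eq[OF prec single that])
  have fin: "finite X" "finite Y" "finite Z"
    unfolding X_def Y_def Z_def deleted_def twisted_def by simp_all
  have st: "e \<in> X \<longleftrightarrow> e \<in> edges G \<and> \<sigma> e = Keep" "e \<in> Y \<longleftrightarrow> e \<in> edges G \<and> \<sigma> e = Delete"
    "e \<in> Z \<longleftrightarrow> e \<in> edges G \<and> \<sigma> e = Twist" for e
    unfolding X_def Y_def Z_def deleted_def twisted_def by auto
  have "(\<Prod>e\<in>edges G. A e) = (\<Prod>e\<in>X. A e) * (\<Prod>e\<in>Y. A e) * (\<Prod>e\<in>Z. A e)"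
    unfolding X_def Y_def Z_def by (rule prod_states)
  also have "(\<Prod>e\<in>X. A e) =
      (\<Prod>e\<in>IA G prec P X. Var (Alpha e)) *
      (\<Prod>e\<in>AO G prec P X. half * Var T * Var (Beta e) + Var (Alpha e)) *
      (\<Prod>e\<in>AN G prec P X. half * Var T * Var (Gamma e) + Var (Alpha e))"
    unfolding prod_activities[OF fin(1), of A prec P]
    by (intro arg_cong2[where f = "(*)"] prod.cong refl)
      (auto simp: IA_def AO_def AN_def st A indet_of_def flip_def)
  also have "(\<Prod>e\<in>Y. A e) =
      (\<Prod>e\<in>IA G prec P Y. Var (Beta e)) *
      (\<Prod>e\<in>AO G prec P Y. half * Var T * Var (Alpha e) + Var (Beta e)) *
      (\<Prod>e\<in>AN G prec P Y. half * Var T * Var (Gamma e) + Var (Beta e))"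
    unfolding prod_activities[OF fin(2), of A prec P]
    by (intro arg_cong2[where f = "(*)"] prod.cong refl)
      (auto simp: IA_def AO_def AN_def st A indet_of_def flip_def)
  also have "(\<Prod>e\<in>Z. A e) =
      (\<Prod>e\<in>IA G prec P Z. Var (Gamma e)) *
      (\<Prod>e\<in>AO G prec P Z. half * Var T * Var (Beta e) + Var (Gamma e)) *
      (\<Prod>e\<in>AN G prec P Z. half * Var T * Var (Alpha e) + Var (Gamma e))"
    unfolding prod_activities[OF fin(3), of A prec P]
    by (intro arg_cong2[where f = "(*)"] prod.cong refl)
      (auto simp: IA_def AO_def AN_def st A indet_of_def flip_def)
  finally show ?thesis
    unfolding A_def P activity_term_def P_def prod.case by (simp only: mult.assoc mult.left_commute mult.commute)
qed

lemma half_add_half: "half + half = (1 :: 'e polynomial)"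
  unfolding half_def by (simp flip: single_add)

theorem transition_polynomial_eq:
  assumes prec: "strict_linear_order_on (edges G) prec"
  shows "transition_polynomial G =
    Var T ^ num_components G * (\<Sum>P\<in>quasi_tree_partitions G. activity_term prec P)"
proof -
  let ?E = "edges G" and ?s = "\<lambda>_. Keep" and ?t = "Var T :: 'e polynomial"
  \<comment> \<open>\<open>prec\<close> may relate elements outside the edge set; the restriction
    makes the edge set down-closed.\<close>
  let ?r = "prec \<inter> ?E \<times> ?E"
  let ?A = "agree ?s ?E"
  have irr: "irrefl prec" and tot: "total_on ?E prec" and tr: "trans prec"
    using prec unfolding strict_linear_order_on_def by auto
  have all: "glued (undecided ?s ?E) = glued (\<lambda>_. UNIV)"
    by (rule glued_cong) (simp add: undecided_def)
  then have all_num: "num_glued (undecided ?s ?E) = num_glued (\<lambda>_. UNIV)"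
    unfolding num_glued_def by simp
  let ?q = "\<lambda>\<sigma>. num_glued (decided \<sigma>) = num_glued (\<lambda>_. UNIV)"
  have quasi: "states_of \<sigma> \<in> quasi_tree_partitions G \<longleftrightarrow> ?q \<sigma>" if "\<sigma> \<in> ?A" for \<sigma>
  proof -
    have "states_of \<sigma> \<in> ordered_partitions3 ?E" using bij_betwE[OF bij_betw_states_of] that by blast
    then show ?thesis
      unfolding quasi_tree_partitions_def
      by (auto simp: states_of_def num_boundary_eq num_components_eq)
  qed
  have qt: "quasi_tree_partitions G = {P \<in> ordered_partitions3 ?E. P \<in> quasi_tree_partitions G}"
    unfolding quasi_tree_partitions_def by auto
  have "transition_polynomial G = (\<Sum>\<sigma>\<in>?A. (\<Prod>e\<in>?E. indet_of e (\<sigma> e)) *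
      (?t ^ num_glued (decided \<sigma>) * ?t ^ card isolated))"
    unfolding transition_polynomial_def
  proof (subst sum.reindex_bij_betw[OF bij_betw_states_of, symmetric], intro sum.cong refl)
    fix \<sigma>
    have "(\<Prod>e\<in>?E. indet_of e (\<sigma> e)) =
      (\<Prod>e\<in>{e \<in> edges G. \<sigma> e = Keep}. Var (Alpha e)) * (\<Prod>e\<in>deleted \<sigma>. Var (Beta e)) *
        (\<Prod>e\<in>twisted \<sigma>. Var (Gamma e))"
      unfolding prod_states[of _ \<sigma>]
      by (intro arg_cong2[where f = "(*)"] prod.cong refl)
        (auto simp: indet_of_def deleted_def twisted_def)
    then show "(case states_of \<sigma> of (X, Y, Z) \<Rightarrow>
        (\<Prod>e\<in>X. Var (Alpha e)) * (\<Prod>e\<in>Y. Var (Beta e)) * (\<Prod>e\<in>Z. Var (Gamma e)) *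
        Var T ^ num_boundary (delete_edges (partial_petrial G Z) Y)) =
      (\<Prod>e\<in>?E. indet_of e (\<sigma> e)) * (?t ^ num_glued (decided \<sigma>) * ?t ^ card isolated)"
      unfolding states_of_def by (simp add: num_boundary_eq power_add)
  qed
  \<comment> \<open>Isolated vertices contribute equally to boundary components and to components,
    so their power of \<open>t\<close> is set aside and rejoins the exponent at the end.\<close>
  also have "\<dots> = ?t ^ card isolated *
      (\<Sum>\<sigma>\<in>?A. (\<Prod>e\<in>?E. indet_of e (\<sigma> e)) * ?t ^ num_glued (decided \<sigma>))"
    by (simp add: sum_distrib_left algebra_simps)
  also have "(\<Sum>\<sigma>\<in>?A. (\<Prod>e\<in>?E. indet_of e (\<sigma> e)) * ?t ^ num_glued (decided \<sigma>)) =
      ?t ^ num_glued (undecided ?s ?E) *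
      (\<Sum>\<sigma>\<in>?A. if num_glued (decided \<sigma>) = num_glued (undecided ?s ?E)
         then \<Prod>e\<in>?E. activity_weight indet_of (half * ?t) ?r \<sigma> e else 0)"
  proof (rule state_sum_eq_activity_sum)
    show "trans ?r" using tr by (auto simp: trans_def)
    show "irrefl ?r" using irr by (auto simp: irrefl_def)
    show "total_on ?E ?r" using tot by (auto simp: total_on_def)
  qed (use edge_has_corner half_add_half in auto)
  also have "(\<Sum>\<sigma>\<in>?A. if num_glued (decided \<sigma>) = num_glued (undecided ?s ?E)
         then \<Prod>e\<in>?E. activity_weight indet_of (half * ?t) ?r \<sigma> e else 0) =
      (\<Sum>\<sigma>\<in>?A. if states_of \<sigma> \<in> quasi_tree_partitions G then activity_term prec (states_of \<sigma>) else 0)"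
  proof (intro sum.cong refl)
    fix \<sigma> assume \<sigma>: "\<sigma> \<in> ?A"
    have "(\<Prod>e\<in>?E. activity_weight indet_of (half * ?t) ?r \<sigma> e) = activity_term prec (states_of \<sigma>)"
      if "?q \<sigma>"
    proof (rule activity_term_eq[OF irr])
      fix x y assume xy: "x \<in> corners G" "(x, y) \<in> glued (\<lambda>_. UNIV)"
      show "(x, y) \<in> glued (decided \<sigma>)"
      \<comment> \<open>Equal numbers of classes turn the inclusion of gluings into equality on
        corners, which is the minimality assumption of the curve lemmas.\<close>
      proof (rule card_quotient_eq_imp_eq[OF equiv_glued equiv_glued _ _ _ xy(1) _ xy(2)])
        show "glued (decided \<sigma>) \<subseteq> glued (\<lambda>_. UNIV)" by (rule glued_mono) simp
        show "y \<in> corners G" using glued_in_C[OF xy(2,1)] .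
      qed (use that in \<open>simp_all add: num_glued_def\<close>)
    qed
    then show "(if num_glued (decided \<sigma>) = num_glued (undecided ?s ?E)
         then \<Prod>e\<in>?E. activity_weight indet_of (half * ?t) ?r \<sigma> e else 0) =
      (if states_of \<sigma> \<in> quasi_tree_partitions G then activity_term prec (states_of \<sigma>) else 0)"
      using quasi[OF \<sigma>] all_num by simp
  qed
  also have "\<dots> = (\<Sum>P\<in>ordered_partitions3 ?E.
      if P \<in> quasi_tree_partitions G then activity_term prec P else 0)"
    by (rule sum.reindex_bij_betw[OF bij_betw_states_of])
  also have "\<dots> = (\<Sum>P\<in>quasi_tree_partitions G. activity_term prec P)"
  proof -
    have "finite (ordered_partitions3 ?E)"
      using bij_betw_finite[OF bij_betw_states_of] finite_agree[of ?E ?s] by simp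
    then show ?thesis
      using sum.inter_filter[of "ordered_partitions3 ?E" "activity_term prec"
        "\<lambda>P. P \<in> quasi_tree_partitions G"] qt by simp
  qed
  finally show ?thesis
    unfolding all_num num_components_eq by (simp add: power_add algebra_simps)
qed

end

theorem theorem6p1:
  fixes G :: "('v, 'e, 'c) ribbon_graph" and prec :: "'e rel"
  assumes "ribbon_graph G"
    and "strict_linear_order_on (edges G) prec"
  shows "transition_polynomial G =
    Var T ^ num_components G *
    (\<Sum>(X, Y, Z)\<in>quasi_tree_partitions G.
      (\<Prod>e\<in>IA G prec (X, Y, Z) X. Var (Alpha e)) *
      (\<Prod>e\<in>IA G prec (X, Y, Z) Y. Var (Beta e)) *
      (\<Prod>e\<in>IA G prec (X, Y, Z) Z. Var (Gamma e)) *
      (\<Prod>e\<in>AO G prec (X, Y, Z) X. half * Var T * Var (Beta e) + Var (Alpha e)) *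
      (\<Prod>e\<in>AO G prec (X, Y, Z) Y. half * Var T * Var (Alpha e) + Var (Beta e)) *
      (\<Prod>e\<in>AO G prec (X, Y, Z) Z. half * Var T * Var (Beta e) + Var (Gamma e)) *
      (\<Prod>e\<in>AN G prec (X, Y, Z) X. half * Var T * Var (Gamma e) + Var (Alpha e)) *
      (\<Prod>e\<in>AN G prec (X, Y, Z) Y. half * Var T * Var (Gamma e) + Var (Beta e)) *
      (\<Prod>e\<in>AN G prec (X, Y, Z) Z. half * Var T * Var (Alpha e) + Var (Gamma e)))"
proof -
  interpret ribbon G by unfold_locales (rule assms(1))
  show ?thesis
    using transition_polynomial_eq[OF assms(2)] unfolding activity_term_def .
qed

end
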